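(* Let $q$ be a prime power, $\mathbb{F}=\mathbb{F}_q$, $m\ge 1$, and let $G\in\mathbb{F}_{q^m}^{k\times n}$ have rank $k$ over $\mathbb{F}_{q^m}$. Let $\mathcal{C}=\mathrm{rowsp}(G)\le\mathbb{F}_{q^m}^n$ and let $\mathcal{M}_G=(\mathbb{F}^n,\rho)$ be the $q$-matroid represented by $G$. Define $A=\big(A_i^{(t)}\big)_{i\in[n]_0,\,t\in[k]_0}\in\mathbb{Z}^{(n+1)\times(k+1)}$ and $S=\big(A_V^{(t)}\big)_{V\in\mathcal{L}(\mathbb{F}^n),\,t\in[k]_0}\in\mathbb{Z}^{\hat n\times(k+1)}$, and let $P,M,F,Q,N,K$ be the matrices defined in the context, where $V^\perp$ is taken with respect to the standard dot product on $\mathbb{F}^n$. Then (a) $S=MPKQ$, and consequently $K=PM^{-1}SQ^{-1}$ (the matrices $P,M,Q$ being invertible over $\mathbb{Z}$); (b) $A=FN^{\mathsf T}Q$, and consequently $N^{\mathsf T}=F^{-1}AQ^{-1}$ (the matrices $F,Q$ being invertible over $\mathbb{Z}$).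
   Context: $[n]_0=\{0,1,\dots,n\}$. For a finite-dimensional $\mathbb{F}$-vector space $E$, $\mathcal{L}(E)$ is its lattice of $\mathbb{F}$-subspaces, and $\hat n=|\mathcal{L}(\mathbb{F}^n)|$; all matrices indexed by $\mathcal{L}(\mathbb{F}^n)$ use one fixed ordering of $\mathcal{L}(\mathbb{F}^n)$. A $q$-matroid on $E$ is a pair $(E,\rho)$ with $\rho:\mathcal{L}(E)\to\mathbb{N}_0$ satisfying $0\le\rho(V)\le\dim V$, $V\le W\Rightarrow\rho(V)\le\rho(W)$, and $\rho(V+W)+\rho(V\cap W)\le\rho(V)+\rho(W)$; its rank is $\rho(E)$. The $q$-matroid represented by $G\in\mathbb{F}_{q^m}^{k\times n}$ is $(\mathbb{F}^n,\rho)$ with $\rho(\mathrm{rowsp}(Y))=\mathrm{rk}_{\mathbb{F}_{q^m}}(GY^{\mathsf T})$ for every $Y\in\mathbb{F}^{t\times n}$. Gaussian binomials: $\left[{a\atop b}\right]_Q$ is the number of $b$-dimensional subspaces of $\mathbb{F}_Q^a$, and is $0$ if $b<0$ or $b>a$. Supports: fix an $\mathbb{F}$-basis of $\mathbb{F}_{q^m}$ and let $\psi:\mathbb{F}_{q^m}\to\mathbb{F}^m$ be the coordinate map (column vectors); for $v\in\mathbb{F}_{q^m}^n$ let $\Psi(v)\in\mathbb{F}^{m\times n}$ be the matrix with columns $\psi(v_1),\dots,\psi(v_n)$, and $\mathrm{supp}(v)=\mathrm{rowsp}_{\mathbb{F}}(\Psi(v))\le\mathbb{F}^n$. For an $\mathbb{F}_{q^m}$-subspace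 $T$, $\mathrm{supp}(T)=\sum_{v\in T}\mathrm{supp}(v)$ and $\mathrm{wt}(T)=\dim_{\mathbb{F}}\mathrm{supp}(T)$. For $t\in[k]_0$ let $\mathcal{D}_t(\mathcal{C})$ be the set of $t$-dimensional $\mathbb{F}_{q^m}$-subspaces of $\mathcal{C}$; $A_i^{(t)}=|\{\mathcal{C}'\in\mathcal{D}_t(\mathcal{C}):\mathrm{wt}(\mathcal{C}')=i\}|$ and $A_V^{(t)}=|\{\mathcal{C}'\in\mathcal{D}_t(\mathcal{C}):\mathrm{supp}(\mathcal{C}')=V\}|$. Let $\nu_{i,j}=|\{V\le\mathbb{F}^n:\rho(V)=k-i,\ \dim V=k-i+j\}|$ for $i\in[k]_0$, $j\in[n-k]_0$, and $\nu_{i,b}=0$ for $b\notin[n-k]_0$. Möbius function of $\mathcal{L}(\mathbb{F}^n)$: $\mu(W,V)=(-1)^{v-w}q^{\binom{v-w}{2}}$ if $W\le V$ (with $v=\dim V$, $w=\dim W$), and $0$ otherwise. Matrices: $P=(\delta_{W,V^\perp})_{W,V\in\mathcal{L}(\mathbb{F}^n)}$; $M=(M_{V,W})$ with $M_{V,W}=\mu(W,V)$; $F=\big((-1)^{i-j}q^{\binom{i-j}{2}}\left[{n-j\atop i-j}\right]_q\big)_{i,j\in[n]_0}$; $Q=\big(\left[{t\atop j}\right]_{q^m}\big)_{t,j\in[k]_0}$; $N=(\nu_{i,\,n-k+i-j})_{i\in[k]_0,\,j\in[n]_0}$; $K=(\delta_{k-\rho(V),\,j})_{V\in\mathcal{L}(\mathbb{F}^n),\,j\in[k]_0}$.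 Here $\delta$ is the Kronecker delta. *)

theory Defs
  imports "Jordan_Normal_Form.DL_Rank" "HOL-Library.Cardinality"
begin

(* The extension of F_q by F_{q^m} is rendered by two finite field types 'f, 'e and a field
   homomorphism \<iota> from 'f to 'e; CARD('f) plays the role of q. *)

section \<open>Subspaces of the standard vector space of dimension n\<close>

definition subspaces :: "nat \<Rightarrow> 'a::field vec set set" where
  "subspaces n = {W. VectorSpace.subspace class_ring W (module_vec TYPE('a) n)}"

definition sdim :: "nat \<Rightarrow> 'a::field vec set \<Rightarrow> nat" where
  "sdim n W = vectorspace.dim class_ring ((module_vec TYPE('a) n)\<lparr>carrier := W\<rparr>)"

(* Vanishes for b > a, where there is no such subspace. *)
definition gauss_binom :: "'a::{field,finite} itself \<Rightarrow> nat \<Rightarrow> nat \<Rightarrow> nat" where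
  "gauss_binom ty a b = card {W :: 'a vec set. W \<in> subspaces a \<and> sdim a W = b}"

definition moebius :: "nat \<Rightarrow> 'f::{field,finite} vec set \<Rightarrow> 'f vec set \<Rightarrow> int" where
  "moebius n W V = (if W \<subseteq> V
     then (-1) ^ (sdim n V - sdim n W) * int CARD('f) ^ ((sdim n V - sdim n W) choose 2)
     else 0)"


section \<open>q-Matroids\<close>

(* Only the values of \<rho> on subspaces matter. *)
definition q_matroid :: "nat \<Rightarrow> ('f::{field,finite} vec set \<Rightarrow> nat) \<Rightarrow> bool" where
  "q_matroid n \<rho> \<longleftrightarrow>
     (\<forall>V\<in>subspaces n. \<rho> V \<le> sdim n V) \<and>
     (\<forall>V\<in>subspaces n. \<forall>W\<in>subspaces n. V \<subseteq> W \<longrightarrow> \<rho> V \<le> \<rho> W) \<and>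
     (\<forall>V\<in>subspaces n. \<forall>W\<in>subspaces n.
        \<rho> (module.submodule_sum (module_vec TYPE('f) n) V W) + \<rho> (V \<inter> W) \<le> \<rho> V + \<rho> W)"

(* The k x n matrix G over the big field represents the q-matroid \<rho>. *)
definition represents ::
    "('f::{field,finite} \<Rightarrow> 'e::{field,finite}) \<Rightarrow> nat \<Rightarrow> nat \<Rightarrow> 'e mat \<Rightarrow> ('f vec set \<Rightarrow> nat) \<Rightarrow> bool" where
  "represents \<iota> k n G \<rho> \<longleftrightarrow> q_matroid n \<rho> \<and>
     (\<forall>t. \<forall>Y\<in>carrier_mat t n.
        \<rho> (vec_space.row_space n Y) = vec_space.rank k (G * (map_mat \<iota> Y)\<^sup>T))"

definition nu :: "nat \<Rightarrow> nat \<Rightarrow> ('f::{field,finite} vec set \<Rightarrow> nat) \<Rightarrow> nat \<Rightarrow> int \<Rightarrow> nat" where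
  "nu n k \<rho> i j = (if 0 \<le> j \<and> j \<le> int n - int k
     then card {V\<in>subspaces n. int (\<rho> V) = int k - int i \<and> int (sdim n V) = int k - int i + j}
     else 0)"


section \<open>Supports and weights\<close>

definition scale :: "('f::field \<Rightarrow> 'e::field) \<Rightarrow> 'f \<Rightarrow> 'e \<Rightarrow> 'e" where
  "scale \<iota> c x = \<iota> c * x"

definition ordered_basis :: "('f::field \<Rightarrow> 'e::field) \<Rightarrow> 'e list \<Rightarrow> bool" where
  "ordered_basis \<iota> bs \<longleftrightarrow> distinct bs \<and>
     \<not> Modules.module.dependent (scale \<iota>) (set bs) \<and>
     Modules.module.span (scale \<iota>) (set bs) = UNIV"

definition coord_vec :: "('f::field \<Rightarrow> 'e::field) \<Rightarrow> 'e list \<Rightarrow> 'e \<Rightarrow> 'f vec" where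
  "coord_vec \<iota> bs x =
     vec (length bs) (\<lambda>l. Modules.module.representation (scale \<iota>) (set bs) x (bs ! l))"

definition coord_mat :: "('f::field \<Rightarrow> 'e::field) \<Rightarrow> 'e list \<Rightarrow> 'e vec \<Rightarrow> 'f mat" where
  "coord_mat \<iota> bs v = mat_of_cols (length bs) (map (coord_vec \<iota> bs) (list_of_vec v))"

definition supp_vec :: "('f::field \<Rightarrow> 'e::field) \<Rightarrow> 'e list \<Rightarrow> nat \<Rightarrow> 'e vec \<Rightarrow> 'f vec set" where
  "supp_vec \<iota> bs n v = vec_space.row_space n (coord_mat \<iota> bs v)"

(* The sum of a family of subspaces is the span of their union. *)
definition supp :: "('f::field \<Rightarrow> 'e::field) \<Rightarrow> 'e list \<Rightarrow> nat \<Rightarrow> 'e vec set \<Rightarrow> 'f vec set" where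
  "supp \<iota> bs n T =
     LinearCombinations.module.span class_ring (module_vec TYPE('f) n) (\<Union>v\<in>T. supp_vec \<iota> bs n v)"

definition wt :: "('f::field \<Rightarrow> 'e::field) \<Rightarrow> 'e list \<Rightarrow> nat \<Rightarrow> 'e vec set \<Rightarrow> nat" where
  "wt \<iota> bs n T = sdim n (supp \<iota> bs n T)"

definition subcodes :: "nat \<Rightarrow> 'e::field vec set \<Rightarrow> nat \<Rightarrow> 'e vec set set" where
  "subcodes n C t = {D\<in>subspaces n. D \<subseteq> C \<and> sdim n D = t}"


section \<open>The matrices\<close>

(* Vs is always an enumeration without repetition of subspaces n, i.e. the fixed ordering used to
   index rows and columns by subspaces. *)

definition A_mat ::
    "('f::{field,finite} \<Rightarrow> 'e::{field,finite}) \<Rightarrow> 'e list \<Rightarrow> nat \<Rightarrow> nat \<Rightarrow> 'e vec set \<Rightarrow> int mat" where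
  "A_mat \<iota> bs n k C =
     mat (n + 1) (k + 1) (\<lambda>(i, t). int (card {D\<in>subcodes n C t. wt \<iota> bs n D = i}))"

definition S_mat ::
    "('f::{field,finite} \<Rightarrow> 'e::{field,finite}) \<Rightarrow> 'e list \<Rightarrow> nat \<Rightarrow> nat \<Rightarrow> 'e vec set \<Rightarrow>
     'f vec set list \<Rightarrow> int mat" where
  "S_mat \<iota> bs n k C Vs =
     mat (length Vs) (k + 1) (\<lambda>(r, t). int (card {D\<in>subcodes n C t. supp \<iota> bs n D = Vs ! r}))"

(* vec_module.orthogonal_complement is taken with respect to the standard dot product. *)
definition P_mat :: "nat \<Rightarrow> 'f::{field,finite} vec set list \<Rightarrow> int mat" where
  "P_mat n Vs = mat (length Vs) (length Vs)
     (\<lambda>(r, c). of_bool (Vs ! r = vec_module.orthogonal_complement n (Vs ! c)))"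

(* The row index is the larger argument: the (V, W) entry is moebius W V. *)
definition M_mat :: "nat \<Rightarrow> 'f::{field,finite} vec set list \<Rightarrow> int mat" where
  "M_mat n Vs = mat (length Vs) (length Vs) (\<lambda>(r, c). moebius n (Vs ! c) (Vs ! r))"

(* The Gaussian binomial in the entry is 0 for i < j. *)
definition F_mat :: "'f::{field,finite} itself \<Rightarrow> nat \<Rightarrow> int mat" where
  "F_mat ty n = mat (n + 1) (n + 1) (\<lambda>(i, j). if j \<le> i
     then (-1) ^ (i - j) * int CARD('f) ^ ((i - j) choose 2) * int (gauss_binom ty (n - j) (i - j))
     else 0)"

definition Q_mat :: "'e::{field,finite} itself \<Rightarrow> nat \<Rightarrow> int mat" where
  "Q_mat ty k = mat (k + 1) (k + 1) (\<lambda>(t, j). int (gauss_binom ty t j))"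

definition N_mat :: "nat \<Rightarrow> nat \<Rightarrow> ('f::{field,finite} vec set \<Rightarrow> nat) \<Rightarrow> int mat" where
  "N_mat n k \<rho> =
     mat (k + 1) (n + 1) (\<lambda>(i, j). int (nu n k \<rho> i (int n - int k + int i - int j)))"

definition K_mat ::
    "nat \<Rightarrow> ('f::{field,finite} vec set \<Rightarrow> nat) \<Rightarrow> 'f vec set list \<Rightarrow> int mat" where
  "K_mat k \<rho> Vs =
     mat (length Vs) (k + 1) (\<lambda>(r, j). of_bool (int k - int (\<rho> (Vs ! r)) = int j))"

(* Meaningful only for A with invertible_mat A; the inverse is then unique. *)
definition mat_inv :: "'a::semiring_1 mat \<Rightarrow> 'a mat" where
  "mat_inv A = (THE B. inverts_mat A B \<and> inverts_mat B A)"

lemma mat_inv_eqI: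
  assumes "inverts_mat A B" "inverts_mat B A"
  shows "mat_inv A = B"
  unfolding mat_inv_def
proof (rule the_equality)
  show "inverts_mat A B \<and> inverts_mat B A" using assms by simp
next
  have uni: "X = Y"
    if "inverts_mat A X" "inverts_mat X A" "inverts_mat A Y" "inverts_mat Y A" for X Y
  proof -
    define a where "a = dim_row A"
    define b where "b = dim_col A"
    have X: "A * X = 1\<^sub>m a" "X * A = 1\<^sub>m (dim_row X)"
      and Y: "A * Y = 1\<^sub>m a" "Y * A = 1\<^sub>m (dim_row Y)"
      using that by (auto simp: inverts_mat_def a_def)
    have X': "dim_col X = a" "dim_row X = b"
      using arg_cong[OF X(1), of dim_col] arg_cong[OF X(2), of dim_col] by (auto simp: b_def)
    have Y': "dim_col Y = a" "dim_row Y = b"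
      using arg_cong[OF Y(1), of dim_col] arg_cong[OF Y(2), of dim_col] by (auto simp: b_def)
    have c: "A \<in> carrier_mat a b" "X \<in> carrier_mat b a" "Y \<in> carrier_mat b a"
      using X' Y' by (auto simp: a_def b_def)
    have "X = X * (A * Y)" using c Y(1) by simp
    also have "\<dots> = (X * A) * Y" using c by (simp add: assoc_mult_mat)
    also have "\<dots> = Y" using X(2) X'(2) c by simp
    finally show ?thesis .
  qed
  show "X = B" if "inverts_mat A X \<and> inverts_mat X A" for X
    using uni[of X B] that assms by blast
qed

end

(* Both identities come from one count. Writing U^perp as the column space of a matrix B over F, a
   codeword xG has its support inside U iff x is orthogonal to the column space of G B, whose dimension
   is rho(U^perp); hence these codewords form a code of dimension k - rho(U^perp), and exactly
   [k - rho(U^perp), t] many t-dimensional subcodes have support inside U. Moebius inversion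
   over the subspace lattice recovers the number of subcodes with support equal to U, which is (a);
   summing over all U of a fixed dimension gives (b). Over finite fields every dimension
   can be read off from a cardinality, so rank-nullity and dim U^perp = n - dim U become counts. *)

theory Submission
  imports Defs
begin

section \<open>Subspaces of finite vector spaces and their counting\<close>

text \<open>The delicate point lies in (b). \<open>nu\<close> is zero by definition once its second
  index leaves the range from 0 to n - k, whereas the count needs, for every j and s, the number of
  W of dimension j with k - \<rho>(W^perp) = s. The two agree because no such W exists outside the
  range. One end of the range is \<rho> \<le> dim; the other says that the words supported in U form
  a code of dimension at most dim U. The second bound is proved on the code itself: a basis of
  U^perp over the small field stays independent over the large one and so imposes n - dim U
  independent equations.

  The dot product over a finite field need not be anisotropic, so W and W^perp may intersect and
  need not span together. Hence dim W^perp comes from fibre counts and not from a direct sum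
  decomposition.

  All inverses have to exist over the integers. P is an involution, M is inverse to the zeta matrix
  of the lattice, and F and Q are lower triangular with unit diagonal, so the adjugate inverts them
  without any division.\<close>

lemma finite_carrier_vec [simp]: "finite (carrier_vec n :: 'a::finite vec set)"
  and card_carrier_vec: "card (carrier_vec n :: 'a::finite vec set) = CARD('a) ^ n"
proof -
  have *: "bij_betw vec_of_list {xs :: 'a list. set xs \<subseteq> UNIV \<and> length xs = n} (carrier_vec n)"
    by (rule bij_betw_byWitness[where f' = list_of_vec])
       (auto simp: vec_list list_vec intro!: carrier_vecI)
  show "finite (carrier_vec n :: 'a vec set)"
    using bij_betw_finite[OF *] finite_lists_length_eq[of "UNIV :: 'a set" n] by simp
  show "card (carrier_vec n :: 'a vec set) = CARD('a) ^ n"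
    using bij_betw_same_card[OF *] card_lists_length_eq[of "UNIV :: 'a set" n] by simp
qed

lemma subspaces_iff:
  "W \<in> subspaces n \<longleftrightarrow> W \<subseteq> carrier_vec n \<and> 0\<^sub>v n \<in> W \<and>
     (\<forall>x\<in>W. \<forall>y\<in>W. x + y \<in> W) \<and> (\<forall>a. \<forall>x\<in>W. a \<cdot>\<^sub>v x \<in> W)"
  using vec_vs[of n, where 'a='a] vec_module[of n, where 'a='a]
  by (auto simp: subspaces_def VectorSpace.subspace_def submodule_def module_vec_simps class_ring_simps)

lemma subspaces_carrier: "W \<in> subspaces n \<Longrightarrow> W \<subseteq> carrier_vec n"
  by (simp add: subspaces_iff)

lemma mult_mat_vec_in_subspace_image:
  fixes B :: "'a::field mat"
  assumes "B \<in> carrier_mat n d"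
  shows "(*\<^sub>v) B ` carrier_vec d \<in> subspaces n"
  unfolding subspaces_iff
proof (intro conjI ballI allI)
  show "(*\<^sub>v) B ` carrier_vec d \<subseteq> carrier_vec n" using assms by auto
  show "0\<^sub>v n \<in> (*\<^sub>v) B ` carrier_vec d" using assms by (intro image_eqI[of _ _ "0\<^sub>v d"]) auto
next
  fix x y assume "x \<in> (*\<^sub>v) B ` carrier_vec d" "y \<in> (*\<^sub>v) B ` carrier_vec d"
  then obtain u v where "u \<in> carrier_vec d" "v \<in> carrier_vec d" "x = B *\<^sub>v u" "y = B *\<^sub>v v" by auto
  then show "x + y \<in> (*\<^sub>v) B ` carrier_vec d"
    using assms by (intro image_eqI[of _ _ "u + v"]) (auto simp: mult_add_distrib_mat_vec)
next
  fix a x assume "x \<in> (*\<^sub>v) B ` carrier_vec d"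
  then obtain u where "u \<in> carrier_vec d" "x = B *\<^sub>v u" by auto
  then show "a \<cdot>\<^sub>v x \<in> (*\<^sub>v) B ` carrier_vec d"
    using assms by (intro image_eqI[of _ _ "a \<cdot>\<^sub>v u"]) auto
qed

lemma inj_on_mult_mat_vec_iff:
  fixes B :: "'a::field mat"
  assumes "B \<in> carrier_mat n d"
  shows "inj_on ((*\<^sub>v) B) (carrier_vec d) \<longleftrightarrow> (\<forall>x\<in>carrier_vec d. B *\<^sub>v x = 0\<^sub>v n \<longrightarrow> x = 0\<^sub>v d)"
proof
  assume inj: "inj_on ((*\<^sub>v) B) (carrier_vec d)"
  have "B *\<^sub>v 0\<^sub>v d = 0\<^sub>v n" using assms by auto
  then show "\<forall>x\<in>carrier_vec d. B *\<^sub>v x = 0\<^sub>v n \<longrightarrow> x = 0\<^sub>v d"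
    using inj by (metis inj_onD zero_carrier_vec)
next
  assume *: "\<forall>x\<in>carrier_vec d. B *\<^sub>v x = 0\<^sub>v n \<longrightarrow> x = 0\<^sub>v d"
  show "inj_on ((*\<^sub>v) B) (carrier_vec d)"
  proof (rule inj_onI)
    fix x y assume x: "x \<in> carrier_vec d" and y: "y \<in> carrier_vec d" and eq: "B *\<^sub>v x = B *\<^sub>v y"
    have "B *\<^sub>v (x - y) = B *\<^sub>v x - B *\<^sub>v y"
      using mult_minus_distrib_mat_vec[OF assms x y] .
    also have "\<dots> = 0\<^sub>v n" using eq assms y by auto
    finally have "x - y = 0\<^sub>v d" using * x y by auto
    then show "x = y" using x y
      by (intro eq_vecI) (auto dest!: arg_cong[where f = "\<lambda>v. v $ i" for i] simp: vec_eq_iff)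
  qed
qed

text \<open>The bridge from the abstract dimension to counting: the columns of \<open>B\<close> are
  a basis of \<open>W\<close>, so \<open>B\<close> maps a coordinate space bijectively onto
  \<open>W\<close>. Cardinalities then determine dimensions.\<close>

lemma subspace_basis_matrix:
  fixes W :: "'a::{field,finite} vec set"
  assumes "W \<in> subspaces n"
  obtains B where "B \<in> carrier_mat n (sdim n W)" "W = (*\<^sub>v) B ` carrier_vec (sdim n W)"
    "inj_on ((*\<^sub>v) B) (carrier_vec (sdim n W))"
proof -
  interpret vec_space "TYPE('a)" n .
  have sub: "VectorSpace.subspace class_ring W V" and mod: "submodule class_ring W V"
    using assms by (simp_all add: subspaces_def VectorSpace.subspace_def)
  have Wc: "W \<subseteq> carrier_vec n" using subspaces_carrier[OF assms] .
  have fin: "finite W" using Wc finite_subset by (blast intro: finite_carrier_vec)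
  interpret W: vectorspace class_ring "vs W" by (rule subspace_is_vs[OF sub])
  \<comment> \<open>\<open>W\<close> is finite and therefore serves as its own finite spanning
    set.\<close>
  have "W.fin_dim" unfolding W.fin_dim_def
    using fin W.in_own_span[of W] W.span_is_subset2[of W] by auto
  then obtain \<beta> where \<beta>: "finite \<beta>" "W.basis \<beta>" using W.finite_basis_exists by auto
  have \<beta>W: "\<beta> \<subseteq> W" and li: "lin_indpt \<beta>" and sp: "span \<beta> = W"
    using \<beta> span_li_not_depend[of \<beta> W] mod unfolding W.basis_def by auto
  have card: "sdim n W = card \<beta>" unfolding sdim_def using W.dim_basis \<beta> by simp
  obtain ws where ws: "set ws = \<beta>" "distinct ws" using finite_distinct_list[OF \<beta>(1)] by auto
  have len: "length ws = sdim n W" using ws card distinct_card by fastforce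
  define B where "B = mat_of_cols n ws"
  have B: "B \<in> carrier_mat n (sdim n W)" using len by (auto simp: B_def)
  have cols: "cols B = ws" using ws \<beta>W Wc by (auto simp: B_def cols_mat_of_cols)
  have "(*\<^sub>v) B ` carrier_vec (sdim n W) = col_space B"
    unfolding col_space_eq[OF B] using B by auto
  also have "\<dots> = W" by (simp add: col_space_def cols ws sp)
  finally have im: "W = (*\<^sub>v) B ` carrier_vec (sdim n W)" ..
  have "inj_on ((*\<^sub>v) B) (carrier_vec (sdim n W))"
    unfolding inj_on_mult_mat_vec_iff[OF B]
  proof (intro ballI impI)
    fix x assume x: "x \<in> carrier_vec (sdim n W)" and Bx: "B *\<^sub>v x = 0\<^sub>v n"
    \<comment> \<open>Independence concerns coefficient functions on the set of basis vectors, while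
      \<open>x\<close> is indexed by positions. Distinctness of \<open>ws\<close> makes the
      translation well defined.\<close>
    define f where "f v = x $ (THE i. i < length ws \<and> ws ! i = v)" for v
    have f: "f (ws ! i) = x $ i" if "i < length ws" for i
    proof -
      have "(THE j. j < length ws \<and> ws ! j = ws ! i) = i"
        using that ws(2) by (auto simp: nth_eq_iff_index_eq)
      then show ?thesis by (simp add: f_def)
    qed
    have "lincomb f \<beta> = lincomb_list (\<lambda>i. f (ws ! i)) ws"
      using lincomb_as_lincomb_list_distinct[of ws f] ws \<beta>W Wc by auto
    also have "\<dots> = B *\<^sub>v vec (length ws) (\<lambda>i. f (ws ! i))"
      unfolding B_def by (rule lincomb_list_as_mat_mult) (use ws \<beta>W Wc in auto)
    also have "vec (length ws) (\<lambda>i. f (ws ! i)) = x"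
      using x len f by auto
    finally have "lincomb f \<beta> = 0\<^sub>v n" using Bx by simp
    then have "f v = 0" if "v \<in> \<beta>" for v
      using li that \<beta>(1) unfolding lin_dep_def by blast
    then have "x $ i = 0" if "i < sdim n W" for i
    proof -
      have "ws ! i \<in> \<beta>" using ws(1) len that nth_mem[of i ws] by simp
      then show ?thesis using f[of i] len that \<open>\<And>v. v \<in> \<beta> \<Longrightarrow> f v = 0\<close> by simp
    qed
    then show "x = 0\<^sub>v (sdim n W)" using x by (intro eq_vecI) auto
  qed
  with B im show thesis by (rule that)
qed

lemma finite_subspaces [simp]: "finite (subspaces n :: 'a::{field,finite} vec set set)"
  by (rule finite_subset[of _ "Pow (carrier_vec n)"]) (auto dest: subspaces_carrier)

lemma finite_subspace: "W \<in> subspaces n \<Longrightarrow> finite (W :: 'a::{field,finite} vec set)"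
  using subspaces_carrier finite_subset finite_carrier_vec by metis

lemma card_subspace:
  fixes W :: "'a::{field,finite} vec set"
  assumes "W \<in> subspaces n"
  shows "card W = CARD('a) ^ sdim n W"
  by (rule subspace_basis_matrix[OF assms]) (metis card_image card_carrier_vec)

lemma CARD_field_gt_1: "1 < CARD('a::{field,finite})"
  using card_mono[of "UNIV :: 'a set" "{0, 1}"] by simp

lemma sdim_eq_iff_card:
  fixes W :: "'a::{field,finite} vec set"
  assumes "W \<in> subspaces n"
  shows "sdim n W = d \<longleftrightarrow> card W = CARD('a) ^ d"
  using card_subspace[OF assms] CARD_field_gt_1[where 'a='a] by simp

lemma sdim_mono:
  fixes W :: "'a::{field,finite} vec set"
  assumes "W \<in> subspaces n" "V \<in> subspaces n" "W \<subseteq> V"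
  shows "sdim n W \<le> sdim n V"
  using card_mono[OF finite_subspace[OF assms(2)] assms(3)] CARD_field_gt_1[where 'a='a]
  by (simp add: card_subspace[OF assms(1)] card_subspace[OF assms(2)])

lemma subspace_eq_of_sdim:
  fixes W :: "'a::{field,finite} vec set"
  assumes "W \<in> subspaces n" "V \<in> subspaces n" "W \<subseteq> V" "sdim n V \<le> sdim n W"
  shows "W = V"
  using sdim_mono[OF assms(1-3)] assms
  by (intro card_subset_eq[OF finite_subspace[OF assms(2)]]) (simp_all add: card_subspace)

lemma carrier_vec_in_subspaces [simp]: "carrier_vec n \<in> subspaces n"
  by (auto simp: subspaces_iff)

lemma zero_in_subspaces [simp]: "{0\<^sub>v n} \<in> subspaces n"
  by (auto simp: subspaces_iff)

lemma sdim_carrier_vec [simp]: "sdim n (carrier_vec n :: 'a::{field,finite} vec set) = n"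
  by (simp add: sdim_eq_iff_card card_carrier_vec)

lemma sdim_zero [simp]: "sdim n {0\<^sub>v n :: 'a::{field,finite} vec} = 0"
  by (simp add: sdim_eq_iff_card)

lemma sdim_le: "W \<in> subspaces n \<Longrightarrow> sdim n (W :: 'a::{field,finite} vec set) \<le> n"
  using sdim_mono[of W n "carrier_vec n"] subspaces_carrier by auto

section \<open>Orthogonal complements over finite fields\<close>

abbreviation perp :: "nat \<Rightarrow> 'a::field vec set \<Rightarrow> 'a vec set" where
  "perp n \<equiv> vec_module.orthogonal_complement n"

lemma perp_def: "perp n W = {x \<in> carrier_vec n. \<forall>y\<in>W. x \<bullet> y = 0}"
  by (simp add: vec_module.orthogonal_complement_def)

lemma perp_in_subspaces:
  fixes W :: "'a::field vec set"
  assumes "W \<subseteq> carrier_vec n"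
  shows "perp n W \<in> subspaces n"
  unfolding subspaces_iff perp_def
  using assms
  by (auto simp: add_scalar_prod_distrib[of _ n] subset_eq scalar_prod_left_zero)

lemma perp_antimono: "W \<subseteq> V \<Longrightarrow> perp n V \<subseteq> perp n W"
  by (rule vec_module.orthogonal_complement_subset)

text \<open>\<open>B\<close> and its transpose are adjoint for the dot product, and a vector
  orthogonal to all unit vectors vanishes. A complement thus becomes a kernel, which can be
  counted.\<close>

lemma perp_image:
  fixes B :: "'a::field mat"
  assumes B: "B \<in> carrier_mat n d"
  shows "perp n ((*\<^sub>v) B ` carrier_vec d) = {x \<in> carrier_vec n. B\<^sup>T *\<^sub>v x = 0\<^sub>v d}"
proof -
  have eq: "x \<bullet> (B *\<^sub>v u) = (B\<^sup>T *\<^sub>v x) \<bullet> u" if "x \<in> carrier_vec n" "u \<in> carrier_vec d" for x u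
    using transpose_vec_mult_scalar[OF B that(2) that(1)] by (rule sym)
  have "(\<forall>u\<in>carrier_vec d. (B\<^sup>T *\<^sub>v x) \<bullet> u = 0) \<longleftrightarrow> B\<^sup>T *\<^sub>v x = 0\<^sub>v d" if x: "x \<in> carrier_vec n" for x
  proof
    assume *: "\<forall>u\<in>carrier_vec d. (B\<^sup>T *\<^sub>v x) \<bullet> u = 0"
    show "B\<^sup>T *\<^sub>v x = 0\<^sub>v d"
    proof (rule eq_vecI)
      fix i assume "i < dim_vec (0\<^sub>v d :: 'a vec)"
      then have i: "i < d" by simp
      have "(B\<^sup>T *\<^sub>v x) \<bullet> unit_vec d i = (B\<^sup>T *\<^sub>v x) $ i" 
        using B x i by (intro scalar_prod_right_unit) auto
      then show "(B\<^sup>T *\<^sub>v x) $ i = 0\<^sub>v d $ i" using * i by (metis index_zero_vec(1) unit_vec_carrier)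
    qed (use B in auto)
  qed (auto simp: scalar_prod_left_zero)
  then show ?thesis by (auto simp: perp_def eq)
qed

text \<open>Rank-nullity in multiplicative form: every nonempty fibre of the map is a translate of
  its kernel.\<close>

lemma card_kernel_image:
  fixes A :: "'a::{field,finite} mat"
  assumes A: "A \<in> carrier_mat d n"
  shows "card {x \<in> carrier_vec n. A *\<^sub>v x = 0\<^sub>v d} * card ((*\<^sub>v) A ` carrier_vec n) = CARD('a) ^ n"
proof -
  let ?K = "{x \<in> carrier_vec n. A *\<^sub>v x = 0\<^sub>v d}" and ?I = "(*\<^sub>v) A ` carrier_vec n"
  let ?F = "\<lambda>y. {x \<in> carrier_vec n. A *\<^sub>v x = y}"
  have fib: "card (?F y) = card ?K" if y: "y \<in> ?I" for y
  proof -
    obtain u where u: "u \<in> carrier_vec n" "y = A *\<^sub>v u" using y by blast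
    have "bij_betw (\<lambda>x. x + u) ?K (?F y)"
    proof (rule bij_betw_byWitness[where f' = "\<lambda>x. x - u"])
      show "\<forall>x\<in>?K. x + u - u = x" "\<forall>x\<in>?F y. x - u + u = x" using u(1) by auto
      show "(\<lambda>x. x + u) ` ?K \<subseteq> ?F y"
        using A u by (auto simp: mult_add_distrib_mat_vec)
      show "(\<lambda>x. x - u) ` ?F y \<subseteq> ?K"
        using A u by (auto simp: mult_minus_distrib_mat_vec)
    qed
    from bij_betw_same_card[OF this] show ?thesis by (rule sym)
  qed
  have "CARD('a) ^ n = card (\<Union>y\<in>?I. ?F y)"
    unfolding card_carrier_vec[symmetric] by (intro arg_cong[where f=card]) auto
  also have "\<dots> = (\<Sum>y\<in>?I. card (?F y))"
    by (rule card_UN_disjoint) (auto simp: finite_carrier_vec)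
  also have "\<dots> = card ?I * card ?K" using fib by simp
  finally show ?thesis by (simp add: mult.commute)
qed

text \<open>Only one inequality at this stage, because the image of the transpose is merely bounded
  by the full coordinate space. It is what is needed to prove that this image is full, after which
  equality follows in \<open>sdim_perp\<close>.\<close>

lemma sdim_perp_ge:
  fixes W :: "'a::{field,finite} vec set"
  assumes W: "W \<in> subspaces n"
  shows "n \<le> sdim n (perp n W) + sdim n W"
proof -
  define d where "d = sdim n W"
  obtain B where B: "B \<in> carrier_mat n d" "W = (*\<^sub>v) B ` carrier_vec d"
    using subspace_basis_matrix[OF W] unfolding d_def by metis
  let ?I = "(*\<^sub>v) B\<^sup>T ` carrier_vec n"
  have "CARD('a) ^ n = card (perp n W) * card ?I"
    using card_kernel_image[of "B\<^sup>T" d n] perp_image[OF B(1)] B by simp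
  also have "\<dots> \<le> card (perp n W) * card (carrier_vec d :: 'a vec set)"
    using B(1) by (intro mult_left_mono card_mono) auto
  also have "\<dots> = CARD('a) ^ (sdim n (perp n W) + sdim n W)"
    using perp_in_subspaces[OF subspaces_carrier[OF W]]
    by (simp add: card_subspace[of _ n] card_carrier_vec power_add d_def)
  finally show ?thesis using CARD_field_gt_1[where 'a='a] by simp
qed

text \<open>The complement of the image of the transpose is the kernel of \<open>B\<close>, which is
  trivial. The inequality \<open>sdim_perp_ge\<close> then leaves no room for a proper
  image.\<close>

lemma transpose_mult_surj_of_inj:
  fixes B :: "'a::{field,finite} mat"
  assumes B: "B \<in> carrier_mat n d" and inj: "inj_on ((*\<^sub>v) B) (carrier_vec d)"
  shows "(*\<^sub>v) B\<^sup>T ` carrier_vec n = carrier_vec d"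
proof -
  let ?I = "(*\<^sub>v) B\<^sup>T ` carrier_vec n"
  have I: "?I \<in> subspaces d" using mult_mat_vec_in_subspace_image[of "B\<^sup>T" d n] B by simp
  have "perp d ?I = {x \<in> carrier_vec d. B *\<^sub>v x = 0\<^sub>v n}"
    using perp_image[of "B\<^sup>T" d n] B by simp
  also have "\<dots> = {0\<^sub>v d}" using inj B unfolding inj_on_mult_mat_vec_iff[OF B] by auto
  finally have "d \<le> sdim d ?I" using sdim_perp_ge[OF I] by simp
  then show ?thesis using I
    by (intro subspace_eq_of_sdim[of _ d]) (simp_all add: subspaces_carrier)
qed

lemma sdim_perp:
  fixes W :: "'a::{field,finite} vec set"
  assumes W: "W \<in> subspaces n"
  shows "sdim n (perp n W) = n - sdim n W"
proof -
  define d where "d = sdim n W"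
  obtain B where B: "B \<in> carrier_mat n d" "W = (*\<^sub>v) B ` carrier_vec d"
    and inj: "inj_on ((*\<^sub>v) B) (carrier_vec d)"
    using subspace_basis_matrix[OF W] unfolding d_def by metis
  have "card (perp n W) * CARD('a) ^ d = CARD('a) ^ n"
    using card_kernel_image[of "B\<^sup>T" d n] perp_image[OF B(1)] B
      transpose_mult_surj_of_inj[OF B(1) inj]
    by (simp add: card_carrier_vec)
  also have "card (perp n W) * CARD('a) ^ d = CARD('a) ^ (sdim n (perp n W) + d)"
    using perp_in_subspaces[OF subspaces_carrier[OF W]] by (simp add: card_subspace power_add)
  finally show ?thesis using CARD_field_gt_1[where 'a='a] by (simp add: d_def)
qed

text \<open>One inclusion is the symmetry of the dot product; equal dimensions turn it into an
  equality.\<close>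

lemma perp_perp:
  fixes W :: "'a::{field,finite} vec set"
  assumes W: "W \<in> subspaces n"
  shows "perp n (perp n W) = W"
proof -
  note p = perp_in_subspaces[OF subspaces_carrier]
  have "W \<subseteq> perp n (perp n W)"
    using subspaces_carrier[OF W] by (auto simp: perp_def subset_eq comm_scalar_prod[of _ n])
  then show ?thesis
    using W sdim_le[OF W]
    by (intro subspace_eq_of_sdim[symmetric]) (auto simp: sdim_perp p)
qed

lemma perp_subset_iff:
  fixes W :: "'a::{field,finite} vec set"
  assumes "W \<in> subspaces n" "V \<in> subspaces n"
  shows "perp n W \<subseteq> perp n V \<longleftrightarrow> V \<subseteq> W"
  using perp_antimono[of V W n] perp_antimono[of "perp n W" "perp n V" n] perp_perp assms by metis

section \<open>Gaussian binomials and the Moebius function\<close>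

text \<open>A basis matrix of \<open>V\<close> carries the full subspace lattice of the coordinate
  space onto the interval below \<open>V\<close>. Preserving both inclusion and dimension, it
  reduces counts inside \<open>V\<close> to counts in a full space.\<close>

lemma subspaces_subset_iso:
  fixes V :: "'a::{field,finite} vec set"
  assumes V: "V \<in> subspaces n"
  obtains \<phi> :: "'a vec set \<Rightarrow> 'a vec set" where "bij_betw \<phi> (subspaces (sdim n V)) {W \<in> subspaces n. W \<subseteq> V}"
    "\<And>U. U \<in> subspaces (sdim n V) \<Longrightarrow> sdim n (\<phi> U) = sdim (sdim n V) U"
    "\<And>U U'. U \<in> subspaces (sdim n V) \<Longrightarrow> U' \<in> subspaces (sdim n V) \<Longrightarrow> \<phi> U \<subseteq> \<phi> U' \<longleftrightarrow> U \<subseteq> U'"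
proof -
  define d where "d = sdim n V"
  obtain B where B: "B \<in> carrier_mat n d" "V = (*\<^sub>v) B ` carrier_vec d"
    and inj: "inj_on ((*\<^sub>v) B) (carrier_vec d)"
    using subspace_basis_matrix[OF V] unfolding d_def by metis
  let ?\<phi> = "\<lambda>U. (*\<^sub>v) B ` U"
  note c = subspaces_carrier[of _ d]
  have im: "?\<phi> U \<in> subspaces n" if U: "U \<in> subspaces d" for U
  proof -
    define e where "e = sdim d U"
    obtain A where A: "A \<in> carrier_mat d e" "U = (*\<^sub>v) A ` carrier_vec e"
      using subspace_basis_matrix[OF U] unfolding e_def by metis
    have "?\<phi> U = (*\<^sub>v) (B * A) ` carrier_vec e"
      unfolding A(2) image_image
      using A(1) B(1) by (intro image_cong) auto
    then show ?thesis using mult_mat_vec_in_subspace_image[of "B * A" n e] A(1) B(1) by simp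
  qed
  have sub: "?\<phi> U \<subseteq> ?\<phi> U' \<longleftrightarrow> U \<subseteq> U'" if "U \<in> subspaces d" "U' \<in> subspaces d" for U U'
  proof
    assume *: "?\<phi> U \<subseteq> ?\<phi> U'"
    show "U \<subseteq> U'"
    proof
      fix x assume x: "x \<in> U"
      then obtain y where y: "y \<in> U'" "B *\<^sub>v x = B *\<^sub>v y" using * by blast
      then have "x = y" using inj_onD[OF inj] x c that by blast
      then show "x \<in> U'" using y by simp
    qed
  qed blast
  have dim: "sdim n (?\<phi> U) = sdim d U" if "U \<in> subspaces d" for U
    using card_image[OF inj_on_subset[OF inj c[OF that]]] im[OF that] that
    by (simp add: sdim_eq_iff_card card_subspace[of _ d])
  have bij: "bij_betw ?\<phi> (subspaces d) {W \<in> subspaces n. W \<subseteq> V}"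
  proof (rule bij_betw_imageI)
    show "inj_on ?\<phi> (subspaces d)"
      using sub by (intro inj_onI equalityI) (metis subset_refl)+
    show "?\<phi> ` subspaces d = {W \<in> subspaces n. W \<subseteq> V}"
    proof (intro equalityI subsetI)
      fix W assume "W \<in> ?\<phi> ` subspaces d"
      then show "W \<in> {W \<in> subspaces n. W \<subseteq> V}" using im c B(2) by blast
    next
      fix W assume W: "W \<in> {W \<in> subspaces n. W \<subseteq> V}"
      \<comment> \<open>The preimage of \<open>W\<close>. Its image is all of \<open>W\<close>
        because \<open>W\<close> lies in \<open>V\<close>, the image of \<open>B\<close>.\<close>
      define U where "U = {x \<in> carrier_vec d. B *\<^sub>v x \<in> W}"
      have "B *\<^sub>v 0\<^sub>v d = 0\<^sub>v n" using B(1) by auto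
      then have "U \<in> subspaces d"
        using W B(1) by (auto simp: U_def subspaces_iff mult_add_distrib_mat_vec mult_mat_vec)
      moreover have "W = ?\<phi> U" using W B(2) by (auto simp: U_def)
      ultimately show "W \<in> ?\<phi> ` subspaces d" by blast
    qed
  qed
  show thesis
  proof (rule that[of ?\<phi>])
    show "bij_betw ?\<phi> (subspaces (sdim n V)) {W \<in> subspaces n. W \<subseteq> V}"
      using bij by (simp only: d_def)
    show "sdim n (?\<phi> U) = sdim (sdim n V) U" if "U \<in> subspaces (sdim n V)" for U
      using dim[of U] that by (simp only: d_def)
    show "?\<phi> U \<subseteq> ?\<phi> U' \<longleftrightarrow> U \<subseteq> U'"
      if "U \<in> subspaces (sdim n V)" "U' \<in> subspaces (sdim n V)" for U U'
      using sub[of U U'] that by (simp only: d_def)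
  qed
qed

lemma card_subspaces_below:
  fixes V :: "'a::{field,finite} vec set"
  assumes "V \<in> subspaces n"
  shows "card {W \<in> subspaces n. W \<subseteq> V \<and> sdim n W = j} = gauss_binom TYPE('a) (sdim n V) j"
proof -
  obtain \<phi> :: "'a vec set \<Rightarrow> 'a vec set" where \<phi>: "bij_betw \<phi> (subspaces (sdim n V)) {W \<in> subspaces n. W \<subseteq> V}"
    and d: "\<And>U. U \<in> subspaces (sdim n V) \<Longrightarrow> sdim n (\<phi> U) = sdim (sdim n V) U"
    by (rule subspaces_subset_iso[OF assms]) simp_all
  have "bij_betw \<phi> {U \<in> subspaces (sdim n V). sdim (sdim n V) U = j}
          {W \<in> {W \<in> subspaces n. W \<subseteq> V}. sdim n W = j}"
    using \<phi> d by (auto simp: bij_betw_def inj_on_def image_iff) (smt (verit) imageI image_iff mem_Collect_eq)+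
  from bij_betw_same_card[OF this, symmetric] show ?thesis by (simp add: gauss_binom_def conj_assoc)
qed

lemma perp_subspace [simp]: "W \<in> subspaces n \<Longrightarrow> perp n W \<in> subspaces n"
  using perp_in_subspaces subspaces_carrier by blast

lemma subset_perp_iff:
  fixes W :: "'a::{field,finite} vec set"
  assumes "W \<in> subspaces n" "V \<in> subspaces n"
  shows "W \<subseteq> perp n V \<longleftrightarrow> V \<subseteq> perp n W"
  using perp_subset_iff[of "perp n W" n V] assms by (simp add: perp_perp)

text \<open>Duality: \<open>perp\<close> reverses inclusion and turns dimension j into n - j, so
  superspaces of \<open>U\<close> become subspaces of its complement.\<close>

lemma card_subspaces_above:
  fixes U :: "'a::{field,finite} vec set"
  assumes "U \<in> subspaces n" "j \<le> n"
  shows "card {W \<in> subspaces n. U \<subseteq> W \<and> sdim n W = j} = gauss_binom TYPE('a) (n - sdim n U) (n - j)"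
proof -
  have "bij_betw (perp n) {W \<in> subspaces n. U \<subseteq> W \<and> sdim n W = j}
          {W \<in> subspaces n. W \<subseteq> perp n U \<and> sdim n W = n - j}"
  proof (rule bij_betw_byWitness[where f' = "perp n"])
    show "perp n ` {W \<in> subspaces n. U \<subseteq> W \<and> sdim n W = j} \<subseteq>
      {W \<in> subspaces n. W \<subseteq> perp n U \<and> sdim n W = n - j}"
      using assms by (auto simp: sdim_perp dest: perp_antimono)
    have "sdim n (perp n W) = j" if "W \<in> subspaces n" "sdim n W = n - j" for W :: "'a vec set"
      using that assms by (simp add: sdim_perp)
    then show "perp n ` {W \<in> subspaces n. W \<subseteq> perp n U \<and> sdim n W = n - j} \<subseteq>
      {W \<in> subspaces n. U \<subseteq> W \<and> sdim n W = j}"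
      using assms subset_perp_iff[of U n] by (simp add: image_subset_iff)
  qed (use perp_perp in auto)
  from bij_betw_same_card[OF this] show ?thesis
    using assms by (simp add: card_subspaces_below sdim_perp)
qed

lemma gauss_binom_sym:
  assumes "j \<le> d"
  shows "gauss_binom TYPE('a::{field,finite}) d (d - j) = gauss_binom TYPE('a) d j"
proof -
  have "{W \<in> subspaces d. {0\<^sub>v d :: 'a vec} \<subseteq> W \<and> sdim d W = j} = {W \<in> subspaces d. sdim d W = j}"
    by (auto simp: subspaces_iff)
  with card_subspaces_above[OF zero_in_subspaces assms, where 'a='a] show ?thesis
    by (simp add: gauss_binom_def)
qed

lemma gauss_binom_eq_0:
  assumes "d < j"
  shows "gauss_binom TYPE('a::{field,finite}) d j = 0"
proof -
  have "sdim d W \<noteq> j" if "W \<in> subspaces d" for W :: "'a vec set"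
    using sdim_le[OF that] assms by simp
  then have "{W :: 'a vec set. W \<in> subspaces d \<and> sdim d W = j} = {}" by simp
  then show ?thesis by (simp only: gauss_binom_def card.empty)
qed

lemma gauss_binom_self [simp]: "gauss_binom TYPE('a::{field,finite}) d d = 1"
proof -
  have "{W \<in> subspaces d. sdim d W = d} = {carrier_vec d :: 'a vec set}"
  proof (intro equalityI subsetI)
    fix W :: "'a vec set" assume "W \<in> {W \<in> subspaces d. sdim d W = d}"
    then have "W = carrier_vec d"
      by (intro subspace_eq_of_sdim[of _ d]) (simp_all add: subspaces_carrier)
    then show "W \<in> {carrier_vec d}" by simp
  qed simp
  then show ?thesis by (simp add: gauss_binom_def)
qed

lemma gauss_binom_0 [simp]: "gauss_binom TYPE('a::{field,finite}) d 0 = 1"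
  using gauss_binom_sym[of d d] by simp

text \<open>The isomorphism onto the interval below \<open>V\<close> makes \<open>V\<close> the
  whole space, and only the condition of lying above the preimage of \<open>U\<close>
  remains.\<close>

lemma card_subspaces_between:
  fixes U V :: "'a::{field,finite} vec set"
  assumes U: "U \<in> subspaces n" and V: "V \<in> subspaces n" and UV: "U \<subseteq> V" and j: "j \<le> sdim n V"
  shows "card {W \<in> subspaces n. U \<subseteq> W \<and> W \<subseteq> V \<and> sdim n W = j} =
    gauss_binom TYPE('a) (sdim n V - sdim n U) (sdim n V - j)"
proof -
  define d where "d = sdim n V"
  obtain \<phi> :: "'a vec set \<Rightarrow> 'a vec set" where \<phi>: "bij_betw \<phi> (subspaces d) {W \<in> subspaces n. W \<subseteq> V}"
    and dim: "\<And>U. U \<in> subspaces d \<Longrightarrow> sdim n (\<phi> U) = sdim d U"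
    and sub: "\<And>U U'. U \<in> subspaces d \<Longrightarrow> U' \<in> subspaces d \<Longrightarrow> \<phi> U \<subseteq> \<phi> U' \<longleftrightarrow> U \<subseteq> U'"
    by (rule subspaces_subset_iso[OF V, folded d_def]) simp_all
  obtain X where X: "X \<in> subspaces d" "U = \<phi> X"
    using \<phi> U UV unfolding bij_betw_def by blast
  have "bij_betw \<phi> {W \<in> subspaces d. X \<subseteq> W \<and> sdim d W = j}
          (\<phi> ` {W \<in> subspaces d. X \<subseteq> W \<and> sdim d W = j})"
    using \<phi> unfolding bij_betw_def by (auto intro: inj_on_subset)
  also have "\<phi> ` {W \<in> subspaces d. X \<subseteq> W \<and> sdim d W = j} =
      {W \<in> subspaces n. U \<subseteq> W \<and> W \<subseteq> V \<and> sdim n W = j}" (is "?L = ?R")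
  proof (intro equalityI subsetI)
    fix W assume "W \<in> ?L"
    then show "W \<in> ?R" using X dim sub bij_betwE[OF \<phi>] by auto
  next
    fix W assume W: "W \<in> ?R"
    then have "W \<in> \<phi> ` subspaces d" using \<phi> by (simp add: bij_betw_def)
    then obtain Y where Y: "W = \<phi> Y" "Y \<in> subspaces d" by (rule imageE)
    have "X \<subseteq> Y" using sub[OF X(1) Y(2)] W X(2) Y(1) by simp
    moreover have "sdim d Y = j" using dim[OF Y(2)] W Y(1) by simp
    ultimately show "W \<in> ?L" unfolding Y(1) using Y(2) by (intro imageI) simp
  qed
  finally have "card {W \<in> subspaces d. X \<subseteq> W \<and> sdim d W = j} =
      card {W \<in> subspaces n. U \<subseteq> W \<and> W \<subseteq> V \<and> sdim n W = j}"
    by (rule bij_betw_same_card)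
  with X j dim show ?thesis by (simp add: card_subspaces_above d_def[symmetric])
qed

section \<open>Recursions for Gaussian binomials and their alternating sum\<close>

text \<open>Double count of the flags consisting of a b-dimensional subspace inside a c-dimensional
  one. The recursions below are special cases of it.\<close>

lemma gauss_binom_mult:
  assumes "b \<le> c" "c \<le> n"
  shows "gauss_binom TYPE('a::{field,finite}) n b * gauss_binom TYPE('a) (n - b) (n - c) =
    gauss_binom TYPE('a) n c * gauss_binom TYPE('a) c b"
proof -
  let ?S = "\<lambda>j. {W :: 'a vec set. W \<in> subspaces n \<and> sdim n W = j}"
  have fin: "finite (?S j)" for j by simp
  have "(\<Sum>W\<in>?S b. card {H \<in> ?S c. W \<subseteq> H}) = (\<Sum>H\<in>?S c. card {W \<in> ?S b. W \<subseteq> H})"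
    by (rule sum_multicount_gen) (use fin in auto)
  moreover have "card {H \<in> ?S c. W \<subseteq> H} = gauss_binom TYPE('a) (n - b) (n - c)" if "W \<in> ?S b" for W
  proof -
    have "{H \<in> ?S c. W \<subseteq> H} = {H \<in> subspaces n. W \<subseteq> H \<and> sdim n H = c}" by auto
    then show ?thesis using card_subspaces_above[of W n c] that assms by simp
  qed
  moreover have "card {W \<in> ?S b. W \<subseteq> H} = gauss_binom TYPE('a) c b" if "H \<in> ?S c" for H
  proof -
    have "{W \<in> ?S b. W \<subseteq> H} = {W \<in> subspaces n. W \<subseteq> H \<and> sdim n W = b}" by auto
    then show ?thesis using card_subspaces_below[of H n b] that assms by simp
  qed
  ultimately show ?thesis by (simp add: gauss_binom_def)
qed

text \<open>The lines partition the nonzero vectors into classes of size q - 1.\<close>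

lemma gauss_binom_1: "gauss_binom TYPE('a::{field,finite}) d 1 * (CARD('a) - 1) = CARD('a) ^ d - 1"
proof -
  let ?L = "{W :: 'a vec set. W \<in> subspaces d \<and> sdim d W = 1}"
  have fin: "finite ?L" by simp
  have card1: "card (W - {0\<^sub>v d}) = CARD('a) - 1" if "W \<in> ?L" for W :: "'a vec set"
    using that card_subspace[of W d] by (simp add: subspaces_iff)
  have disj: "(W - {0\<^sub>v d}) \<inter> (W' - {0\<^sub>v d}) = {}" if WW': "W \<in> ?L" "W' \<in> ?L" "W \<noteq> W'" for W W' :: "'a vec set"
  proof (rule ccontr)
    assume "(W - {0\<^sub>v d}) \<inter> (W' - {0\<^sub>v d}) \<noteq> {}"
    then obtain x where x: "x \<in> W \<inter> W'" "x \<noteq> 0\<^sub>v d" by blast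
    have I: "W \<inter> W' \<in> subspaces d" using WW' by (simp add: subspaces_iff) blast
    have "sdim d (W \<inter> W') \<noteq> 0"
    proof
      assume "sdim d (W \<inter> W') = 0"
      then have "card (W \<inter> W') = 1" using sdim_eq_iff_card[OF I, of 0] by simp
      moreover have "0\<^sub>v d \<in> W \<inter> W'" using I by (simp add: subspaces_iff)
      ultimately show False using x by (metis card_1_singletonE singletonD)
    qed
    \<comment> \<open>The intersection has positive dimension, while both lines have dimension
      1.\<close>
    then have "sdim d W \<le> sdim d (W \<inter> W')" "sdim d W' \<le> sdim d (W \<inter> W')" using WW' by auto
    then have "W \<inter> W' = W" "W \<inter> W' = W'"
      using subspace_eq_of_sdim[OF I, of W] subspace_eq_of_sdim[OF I, of W'] WW' by simp_all
    then show False using WW'(3) by simp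
  qed
  have cover: "(\<Union>W\<in>?L. W - {0\<^sub>v d}) = carrier_vec d - {0\<^sub>v d}"
  proof (intro equalityI subsetI)
    fix x :: "'a vec" assume "x \<in> (\<Union>W\<in>?L. W - {0\<^sub>v d})"
    then show "x \<in> carrier_vec d - {0\<^sub>v d}" by (auto dest: subspaces_carrier)
  next
    fix x :: "'a vec" assume x: "x \<in> carrier_vec d - {0\<^sub>v d}"
    then obtain i where i: "i < d" "x $ i \<noteq> 0" by (auto simp: vec_eq_iff)
    let ?W = "range (\<lambda>a. a \<cdot>\<^sub>v x)"
    have W: "?W \<in> subspaces d"
      unfolding subspaces_iff
    proof (intro conjI ballI allI)
      show "?W \<subseteq> carrier_vec d" using x by auto
      show "0\<^sub>v d \<in> ?W" using x by (intro range_eqI[of _ _ 0]) auto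
      show "u + v \<in> ?W" if "u \<in> ?W" "v \<in> ?W" for u v
        using that by (auto simp: add_smult_distrib_vec[symmetric])
      show "a \<cdot>\<^sub>v u \<in> ?W" if "u \<in> ?W" for a u
        using that by (auto simp: smult_smult_assoc)
    qed
    have "inj (\<lambda>a. a \<cdot>\<^sub>v x)"
    proof (rule injI)
      fix a b assume "a \<cdot>\<^sub>v x = b \<cdot>\<^sub>v x"
      then have "(a \<cdot>\<^sub>v x) $ i = (b \<cdot>\<^sub>v x) $ i" by simp
      then show "a = b" using i x by auto
    qed
    then have "card ?W = CARD('a)" by (simp add: card_image)
    then have "?W \<in> ?L" using W by (simp add: sdim_eq_iff_card)
    moreover have "x \<in> ?W" by (intro range_eqI[of _ _ 1]) simp
    ultimately show "x \<in> (\<Union>W\<in>?L. W - {0\<^sub>v d})" using x by blast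
  qed
  have "CARD('a) ^ d - 1 = card (\<Union>W\<in>?L. W - {0\<^sub>v d})"
    unfolding cover by (simp add: card_carrier_vec)
  also have "\<dots> = (\<Sum>W\<in>?L. card (W - {0\<^sub>v d}))"
    using fin disj by (intro card_UN_disjoint) (auto simp: finite_subspace)
  also have "\<dots> = card ?L * (CARD('a) - 1)" using card1 by simp
  finally show ?thesis by (simp add: gauss_binom_def)
qed

lemma gauss_binom_1_int:
  "int (gauss_binom TYPE('a::{field,finite}) d 1) * (int CARD('a) - 1) = int CARD('a) ^ d - 1"
proof -
  have "int (gauss_binom TYPE('a) d 1 * (CARD('a) - 1)) = int (CARD('a) ^ d - 1)"
    by (simp only: gauss_binom_1)
  then show ?thesis by (simp add: of_nat_diff Suc_leI)
qed

text \<open>Flags with dimensions b and b + 1. By symmetry both cofactors are numbers of lines, and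
  multiplying by q - 1 makes them explicit.\<close>

lemma gauss_binom_Suc_right:
  fixes d b :: nat
  defines "q \<equiv> int CARD('a::{field,finite})"
  assumes "b \<le> d"
  shows "int (gauss_binom TYPE('a) d (Suc b)) * (q ^ Suc b - 1) = int (gauss_binom TYPE('a) d b) * (q ^ (d - b) - 1)"
proof (cases "b = d")
  case True
  then show ?thesis by (simp add: gauss_binom_eq_0)
next
  case False
  then have b: "b < d" using assms by simp
  let ?g = "\<lambda>d b. int (gauss_binom TYPE('a) d b)"
  have "gauss_binom TYPE('a) (d - b) (d - Suc b) = gauss_binom TYPE('a) (d - b) 1"
    using gauss_binom_sym[of 1 "d - b", where 'a='a] b by simp
  moreover have "gauss_binom TYPE('a) (Suc b) b = gauss_binom TYPE('a) (Suc b) 1"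
    using gauss_binom_sym[of 1 "Suc b", where 'a='a] by simp
  ultimately have "?g d b * ?g (d - b) 1 = ?g d (Suc b) * ?g (Suc b) 1"
    using gauss_binom_mult[of b "Suc b" d, where 'a='a] b by (simp flip: of_nat_mult)
  then have "?g d b * (?g (d - b) 1 * (q - 1)) = ?g d (Suc b) * (?g (Suc b) 1 * (q - 1))"
    by (simp add: mult.assoc[symmetric])
  then show ?thesis by (simp only: gauss_binom_1_int q_def)
qed

text \<open>Flags whose larger member is a hyperplane of the (d + 1)-dimensional space.\<close>

lemma gauss_binom_Suc_left:
  fixes d b :: nat
  defines "q \<equiv> int CARD('a::{field,finite})"
  assumes "b \<le> d"
  shows "int (gauss_binom TYPE('a) (Suc d) b) * (q ^ (Suc d - b) - 1) = int (gauss_binom TYPE('a) d b) * (q ^ Suc d - 1)"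
proof -
  let ?g = "\<lambda>d b. int (gauss_binom TYPE('a) d b)"
  have "gauss_binom TYPE('a) (Suc d) d = gauss_binom TYPE('a) (Suc d) 1"
    using gauss_binom_sym[of 1 "Suc d", where 'a='a] by simp
  then have "?g (Suc d) b * ?g (Suc d - b) 1 = ?g (Suc d) 1 * ?g d b"
    using gauss_binom_mult[of b d "Suc d", where 'a='a] assms(2) by (simp flip: of_nat_mult)
  then have "?g (Suc d) b * (?g (Suc d - b) 1 * (q - 1)) = ?g d b * (?g (Suc d) 1 * (q - 1))"
    by (simp add: algebra_simps)
  then show ?thesis by (simp only: gauss_binom_1_int q_def)
qed

text \<open>After multiplication by q^(r+1) - 1 the two recursions leave the splitting q^(d+1) - 1 =
  q^(r+1) (q^(d-r) - 1) + (q^(r+1) - 1); the factor is nonzero since q > 1 and cancels. The power of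
  q stands at the term that makes the alternating sum telescope.\<close>

lemma gauss_binom_pascal:
  "gauss_binom TYPE('a::{field,finite}) (Suc d) (Suc r) =
     CARD('a) ^ Suc r * gauss_binom TYPE('a) d (Suc r) + gauss_binom TYPE('a) d r"
proof (cases "r \<le> d")
  case True
  define q where "q = int CARD('a)"
  let ?g = "\<lambda>d b. int (gauss_binom TYPE('a) d b)"
  have nz: "q ^ Suc r - 1 \<noteq> 0"
    using CARD_field_gt_1[where 'a='a] one_less_power[of q "Suc r"] by (simp add: q_def del: power_Suc)
  have "?g (Suc d) (Suc r) * (q ^ Suc r - 1) = ?g d r * (q ^ Suc d - 1)"
    using gauss_binom_Suc_right[of r "Suc d", where 'a='a] gauss_binom_Suc_left[of r d, where 'a='a] True
    by (simp only: q_def le_SucI)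
  also have "q ^ Suc d = q ^ Suc r * q ^ (d - r)"
    using True by (simp flip: power_add)
  also have "?g d r * (q ^ Suc r * q ^ (d - r) - 1) =
      q ^ Suc r * (?g d r * (q ^ (d - r) - 1)) + ?g d r * (q ^ Suc r - 1)"
    by (simp add: algebra_simps)
  also have "?g d r * (q ^ (d - r) - 1) = ?g d (Suc r) * (q ^ Suc r - 1)"
    using gauss_binom_Suc_right[OF True, where 'a='a] by (simp only: q_def)
  also have "q ^ Suc r * (?g d (Suc r) * (q ^ Suc r - 1)) + ?g d r * (q ^ Suc r - 1) =
      (q ^ Suc r * ?g d (Suc r) + ?g d r) * (q ^ Suc r - 1)"
    by (simp only: distrib_right mult.assoc)
  finally have "?g (Suc d) (Suc r) = q ^ Suc r * ?g d (Suc r) + ?g d r"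
    using nz by simp
  then have "int (gauss_binom TYPE('a) (Suc d) (Suc r)) =
      int (CARD('a) ^ Suc r * gauss_binom TYPE('a) d (Suc r) + gauss_binom TYPE('a) d r)"
    by (simp add: q_def)
  then show ?thesis by (simp only: of_nat_eq_iff)
qed (simp add: gauss_binom_eq_0)

text \<open>The closed form of the partial sums makes the induction work: the new term is split by
  \<open>gauss_binom_pascal\<close>, one half cancels the old sum, and the factor q^(r+1) raises the
  exponent to the next binomial coefficient.\<close>

lemma gauss_binom_alternating_partial:
  fixes d r :: nat
  defines "q \<equiv> int CARD('a::{field,finite})"
  shows "(\<Sum>j\<le>r. (-1) ^ j * q ^ (j choose 2) * int (gauss_binom TYPE('a) (Suc d) j)) =
    (-1) ^ r * q ^ (Suc r choose 2) * int (gauss_binom TYPE('a) d r)"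
proof (induction r)
  case 0
  then show ?case by (simp add: numeral_2_eq_2)
next
  case (Suc r)
  have "Suc (Suc r) choose 2 = Suc r + (Suc r choose 2)" by (simp add: numeral_2_eq_2)
  then show ?case
    using Suc by (simp add: gauss_binom_pascal q_def power_add algebra_simps del: power_Suc)
qed

lemma gauss_binom_alternating:
  fixes d :: nat
  defines "q \<equiv> int CARD('a::{field,finite})"
  shows "(\<Sum>j\<le>d. (-1) ^ j * q ^ (j choose 2) * int (gauss_binom TYPE('a) d j)) = of_bool (d = 0)"
proof (cases d)
  case 0
  then show ?thesis by (simp add: numeral_2_eq_2)
next
  case (Suc e)
  then show ?thesis
    \<comment> \<open>At r = e + 1 the closed form contains the Gaussian binomial of e + 1 in e,
      which is zero.\<close>
    using gauss_binom_alternating_partial[where 'a='a and d=e and r="Suc e"] by (simp add: q_def gauss_binom_eq_0)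
qed

text \<open>The sum lives on the interval from \<open>U\<close> to \<open>V\<close>, where the
  summand depends only on the dimension of \<open>W\<close>. Grouping gives the alternating sum of
  Gaussian binomials for the length of the interval.\<close>

lemma moebius_sum:
  fixes U V :: "'f::{field,finite} vec set"
  assumes U: "U \<in> subspaces n" and V: "V \<in> subspaces n"
  shows "(\<Sum>W\<in>{W \<in> subspaces n. U \<subseteq> W}. moebius n W V) = of_bool (U = V)"
proof (cases "U \<subseteq> V")
  case False
  then have "moebius n W V = 0" if "U \<subseteq> W" for W using that by (auto simp: moebius_def)
  then show ?thesis using False by (auto intro: sum.neutral)
next
  case True
  define v u where "v = sdim n V" and "u = sdim n U"
  have uv: "u \<le> v" using sdim_mono[OF U V True] by (simp add: u_def v_def)
  let ?I = "{W \<in> subspaces n. U \<subseteq> W \<and> W \<subseteq> V}"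
  let ?h = "\<lambda>j. (-1) ^ j * int CARD('f) ^ (j choose 2)"
  have "(\<Sum>W\<in>{W \<in> subspaces n. U \<subseteq> W}. moebius n W V) = (\<Sum>W\<in>?I. ?h (v - sdim n W))"
    by (rule sum.mono_neutral_cong_right) (auto simp: moebius_def v_def)
  \<comment> \<open>Grouping by codimension in \<open>V\<close> matches the exponents in
    \<open>moebius\<close> and the lower index in \<open>card_subspaces_between\<close>.\<close>
  also have "\<dots> = (\<Sum>j\<le>v - u. \<Sum>W\<in>{W \<in> ?I. v - sdim n W = j}. ?h (v - sdim n W))"
    by (rule sum.group[symmetric]) (auto simp: u_def intro!: diff_le_mono2 sdim_mono U)
  also have "\<dots> = (\<Sum>j\<le>v - u. ?h j * int (gauss_binom TYPE('f) (v - u) j))"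
  proof (rule sum.cong[OF refl])
    fix j assume "j \<in> {..v - u}"
    then have j: "j \<le> v - u" by simp
    have "{W \<in> ?I. v - sdim n W = j} = {W \<in> subspaces n. U \<subseteq> W \<and> W \<subseteq> V \<and> sdim n W = v - j}"
      using j sdim_mono[OF _ V] by (auto simp: v_def)
    moreover have "card {W \<in> subspaces n. U \<subseteq> W \<and> W \<subseteq> V \<and> sdim n W = v - j} = gauss_binom TYPE('f) (v - u) j"
      using card_subspaces_between[OF U V True, of "v - j"] j by (simp add: v_def u_def)
    ultimately show "(\<Sum>W\<in>{W \<in> ?I. v - sdim n W = j}. ?h (v - sdim n W)) =
        ?h j * int (gauss_binom TYPE('f) (v - u) j)"
      using j by (simp add: mult.commute)
  qed
  also have "\<dots> = of_bool (v - u = 0)" by (rule gauss_binom_alternating)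
  also have "v - u = 0 \<longleftrightarrow> U = V"
    using subspace_eq_of_sdim[OF U V True] uv by (auto simp: u_def v_def)
  finally show ?thesis .
qed

section \<open>Supports and the represented q-matroid\<close>

text \<open>The rows of \<open>A\<close> are preimages of the unit vectors under the surjective
  transpose of \<open>B\<close>. Unlike injectivity, an equation between matrices passes entrywise
  to an extension field, which is why this form is wanted.\<close>

lemma left_inverse_of_inj:
  fixes B :: "'a::{field,finite} mat"
  assumes B: "B \<in> carrier_mat n d" and inj: "inj_on ((*\<^sub>v) B) (carrier_vec d)"
  obtains A where "A \<in> carrier_mat d n" "A * B = 1\<^sub>m d"
proof -
  have "\<forall>i<d. \<exists>a\<in>carrier_vec n. B\<^sup>T *\<^sub>v a = unit_vec d i"
    using transpose_mult_surj_of_inj[OF B inj] by (metis imageE unit_vec_carrier)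
  then obtain a where a: "\<And>i. i < d \<Longrightarrow> a i \<in> carrier_vec n" "\<And>i. i < d \<Longrightarrow> B\<^sup>T *\<^sub>v a i = unit_vec d i"
    by metis
  define A where "A = mat_of_rows n (map a [0..<d])"
  have A: "A \<in> carrier_mat d n" by (simp add: A_def mat_of_rows_def)
  have "A * B = 1\<^sub>m d"
  proof (rule eq_matI)
    fix i j assume "i < dim_row (1\<^sub>m d :: 'a mat)" "j < dim_col (1\<^sub>m d :: 'a mat)"
    then have ij: "i < d" "j < d" by simp_all
    have "(A * B) $$ (i, j) = a i \<bullet> col B j"
      using A B ij a(1)[OF ij(1)] by (simp add: A_def)
    also have "\<dots> = col B j \<bullet> a i"
      using a(1)[OF ij(1)] B by (intro comm_scalar_prod[of _ n]) auto
    also have "\<dots> = (B\<^sup>T *\<^sub>v a i) $ j" using B ij by simp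
    also have "\<dots> = 1\<^sub>m d $$ (i, j)" using a(2)[OF ij(1)] ij by simp
    finally show "(A * B) $$ (i, j) = 1\<^sub>m d $$ (i, j)" .
  qed (use A B in auto)
  with A show thesis by (rule that)
qed

lemma row_space_eq_image:
  fixes A :: "'a::field mat"
  assumes "A \<in> carrier_mat r n"
  shows "vec_space.row_space n A = (*\<^sub>v) A\<^sup>T ` carrier_vec r"
proof -
  have "A\<^sup>T *\<^sub>v y \<in> carrier_vec n" if "y \<in> carrier_vec r" for y
    using assms that by auto
  then show ?thesis using assms by (auto simp: vec_space.row_space_eq[OF assms])
qed

lemma rank_eq_sdim_image:
  fixes A :: "'a::field mat"
  assumes "A \<in> carrier_mat k c"
  shows "vec_space.rank k A = sdim k ((*\<^sub>v) A ` carrier_vec c)"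
proof -
  have "vec_space.col_space k A = (*\<^sub>v) A ` carrier_vec c"
    using row_space_eq_image[of "A\<^sup>T" c k] assms
    by (simp add: vec_space.row_space_eq_col_space_transpose)
  then show ?thesis by (simp add: vec_space.rank_def sdim_def vec_space.col_space_def)
qed

lemma row_space_in_subspaces:
  fixes A :: "'a::field mat"
  assumes "A \<in> carrier_mat r n"
  shows "vec_space.row_space n A \<in> subspaces n"
  using mult_mat_vec_in_subspace_image[of "A\<^sup>T" n r] assms by (simp add: row_space_eq_image)

lemma perp_row_space:
  fixes A :: "'a::field mat"
  assumes "A \<in> carrier_mat r n"
  shows "perp n (vec_space.row_space n A) = {x \<in> carrier_vec n. A *\<^sub>v x = 0\<^sub>v r}"
  using perp_image[of "A\<^sup>T" n r] assms by (simp add: row_space_eq_image)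

section \<open>Supports over a field extension\<close>

locale field_extension_basis = field_hom \<iota>
  for \<iota> :: "'f::{field,finite} \<Rightarrow> 'e::{field,finite}" +
  fixes bs :: "'e list"
  assumes basis: "ordered_basis \<iota> bs"
begin

sublocale ext: vector_space "scale \<iota>"
  by unfold_locales (simp_all add: scale_def algebra_simps hom_add hom_mult)

lemma sum_basis: "(\<Sum>l<length bs. f (bs ! l)) = sum f (set bs)"
  using basis by (intro sum.reindex_bij_betw bij_betw_nth) (auto simp: ordered_basis_def)

lemma coord_vec_sum: "(\<Sum>l<length bs. \<iota> (coord_vec \<iota> bs x $ l) * bs ! l) = x"
proof -
  have "(\<Sum>l<length bs. \<iota> (coord_vec \<iota> bs x $ l) * bs ! l) =
      (\<Sum>l<length bs. scale \<iota> (ext.representation (set bs) x (bs ! l)) (bs ! l))"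
    by (rule sum.cong) (simp_all add: coord_vec_def scale_def)
  also have "\<dots> = (\<Sum>b\<in>set bs. scale \<iota> (ext.representation (set bs) x b) b)"
    by (rule sum_basis)
  also have "\<dots> = x"
    using basis by (intro ext.sum_representation_eq) (auto simp: ordered_basis_def)
  finally show ?thesis .
qed

lemma basis_independent:
  assumes "(\<Sum>l<length bs. \<iota> (a l) * bs ! l) = 0" "l < length bs"
  shows "a l = 0"
proof -
  have d: "distinct bs" and ind: "ext.independent (set bs)"
    using basis by (auto simp: ordered_basis_def)
  define u where "u b = a (THE i. i < length bs \<and> bs ! i = b)" for b
  have u: "u (bs ! i) = a i" if "i < length bs" for i
  proof -
    have "(THE j. j < length bs \<and> bs ! j = bs ! i) = i"
      using that d by (auto simp: nth_eq_iff_index_eq)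
    then show ?thesis by (simp add: u_def)
  qed
  have "(\<Sum>b\<in>set bs. scale \<iota> (u b) b) = (\<Sum>l<length bs. scale \<iota> (u (bs ! l)) (bs ! l))"
    by (rule sum_basis[symmetric])
  also have "\<dots> = (\<Sum>l<length bs. \<iota> (a l) * bs ! l)"
    by (rule sum.cong) (simp_all add: u scale_def)
  finally have "(\<Sum>b\<in>set bs. scale \<iota> (u b) b) = 0" using assms(1) by simp
  from ext.independentD[OF ind _ _ this, of "bs ! l"] show ?thesis
    using u[OF assms(2)] assms(2) by simp
qed

lemma coord_mat_carrier: "v \<in> carrier_vec n \<Longrightarrow> coord_mat \<iota> bs v \<in> carrier_mat (length bs) n"
  by (simp add: coord_mat_def mat_of_cols_def)

lemma coord_mat_index:
  assumes "v \<in> carrier_vec n" "l < length bs" "i < n"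
  shows "coord_mat \<iota> bs v $$ (l, i) = coord_vec \<iota> bs (v $ i) $ l"
  using assms by (simp add: coord_mat_def mat_of_cols_def list_of_vec_index)

text \<open>Expanded in the basis \<open>bs\<close>, the product of \<open>v\<close> with the lifted
  \<open>b\<close> has exactly the entries of \<open>coord_mat\<close> times \<open>b\<close> as
  coefficients. One equation over the large field therefore equals a system over the small
  one.\<close>

lemma coord_mat_mult_eq_0_iff:
  assumes v: "v \<in> carrier_vec n" and b: "b \<in> carrier_vec n"
  shows "coord_mat \<iota> bs v *\<^sub>v b = 0\<^sub>v (length bs) \<longleftrightarrow> v \<bullet> map_vec \<iota> b = 0"
proof -
  have c: "(coord_mat \<iota> bs v *\<^sub>v b) $ l = (\<Sum>i<n. coord_vec \<iota> bs (v $ i) $ l * b $ i)" if "l < length bs" for l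
    using coord_mat_carrier[OF v] coord_mat_index[OF v that] b that
    by (auto simp: scalar_prod_def lessThan_atLeast0 intro!: sum.cong)
  have "v \<bullet> map_vec \<iota> b = (\<Sum>i<n. v $ i * \<iota> (b $ i))"
    using v b by (simp add: scalar_prod_def lessThan_atLeast0)
  also have "\<dots> = (\<Sum>i<n. \<Sum>l<length bs. \<iota> (coord_vec \<iota> bs (v $ i) $ l) * bs ! l * \<iota> (b $ i))"
    by (simp only: coord_vec_sum sum_distrib_right[symmetric])
  also have "\<dots> = (\<Sum>l<length bs. \<Sum>i<n. \<iota> (coord_vec \<iota> bs (v $ i) $ l) * bs ! l * \<iota> (b $ i))"
    by (rule sum.swap)
  also have "\<dots> = (\<Sum>l<length bs. \<iota> ((coord_mat \<iota> bs v *\<^sub>v b) $ l) * bs ! l)"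
    by (rule sum.cong) (simp_all add: c hom_sum hom_mult sum_distrib_right sum_distrib_left ac_simps del: index_mult_mat_vec)
  finally have eq: "v \<bullet> map_vec \<iota> b = (\<Sum>l<length bs. \<iota> ((coord_mat \<iota> bs v *\<^sub>v b) $ l) * bs ! l)" .
  show ?thesis
  proof
    assume "coord_mat \<iota> bs v *\<^sub>v b = 0\<^sub>v (length bs)"
    then show "v \<bullet> map_vec \<iota> b = 0" unfolding eq by simp
  next
    assume "v \<bullet> map_vec \<iota> b = 0"
    then have "(coord_mat \<iota> bs v *\<^sub>v b) $ l = 0" if "l < length bs" for l
      using basis_independent[OF _ that] unfolding eq by blast
    then show "coord_mat \<iota> bs v *\<^sub>v b = 0\<^sub>v (length bs)"
      using coord_mat_carrier[OF v] by (intro eq_vecI) (simp_all del: index_mult_mat_vec)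
  qed
qed

lemma supp_vec_in_subspaces: "v \<in> carrier_vec n \<Longrightarrow> supp_vec \<iota> bs n v \<in> subspaces n"
  unfolding supp_vec_def by (rule row_space_in_subspaces[OF coord_mat_carrier])

text \<open>Dualising turns containment of supports into linear equations over the large field, with
  coefficients from the small field.\<close>

lemma supp_vec_subset_iff:
  assumes v: "v \<in> carrier_vec n" and U: "U \<in> subspaces n"
  shows "supp_vec \<iota> bs n v \<subseteq> U \<longleftrightarrow> (\<forall>b\<in>perp n U. v \<bullet> map_vec \<iota> b = 0)"
proof -
  have "supp_vec \<iota> bs n v \<subseteq> U \<longleftrightarrow> perp n U \<subseteq> perp n (supp_vec \<iota> bs n v)"
    using perp_subset_iff[OF U supp_vec_in_subspaces[OF v]] by simp
  also have "perp n (supp_vec \<iota> bs n v) = {b \<in> carrier_vec n. v \<bullet> map_vec \<iota> b = 0}"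
    unfolding supp_vec_def perp_row_space[OF coord_mat_carrier[OF v]]
    using coord_mat_mult_eq_0_iff[OF v] by blast
  also have "perp n U \<subseteq> \<dots> \<longleftrightarrow> (\<forall>b\<in>perp n U. v \<bullet> map_vec \<iota> b = 0)"
    unfolding perp_def by blast
  finally show ?thesis .
qed

lemma
  assumes D: "D \<subseteq> carrier_vec n"
  shows supp_in_subspaces: "supp \<iota> bs n D \<in> subspaces n"
    and supp_subset_iff: "U \<in> subspaces n \<Longrightarrow> supp \<iota> bs n D \<subseteq> U \<longleftrightarrow> (\<forall>v\<in>D. supp_vec \<iota> bs n v \<subseteq> U)"
proof -
  interpret vec_space "TYPE('f)" n .
  let ?X = "\<Union>v\<in>D. supp_vec \<iota> bs n v"
  have "supp_vec \<iota> bs n v \<subseteq> carrier_vec n" if "v \<in> D" for v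
    using subspaces_carrier[OF supp_vec_in_subspaces] D that by blast
  then have X: "?X \<subseteq> carrier_vec n" by blast
  show "supp \<iota> bs n D \<in> subspaces n"
    using span_is_subspace[OF X] by (simp add: subspaces_def supp_def)
  show "supp \<iota> bs n D \<subseteq> U \<longleftrightarrow> (\<forall>v\<in>D. supp_vec \<iota> bs n v \<subseteq> U)" if U: "U \<in> subspaces n"
  proof -
    have "submodule class_ring U V" using U by (simp add: subspaces_def VectorSpace.subspace_def)
    then have "supp \<iota> bs n D \<subseteq> U \<longleftrightarrow> ?X \<subseteq> U"
      using span_is_subset[of ?X U] in_own_span[OF X] unfolding supp_def by blast
    then show ?thesis by blast
  qed
qed

end

section \<open>Subcodes supported in a given subspace\<close>

context field_extension_basis
begin

text \<open>Lifted vectors include the unit vectors, so they suffice to test for zero over the large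
  field.\<close>

lemma all_scalar_prod_hom_eq_0_iff:
  assumes y: "y \<in> carrier_vec d"
  shows "(\<forall>z\<in>carrier_vec d. y \<bullet> map_vec \<iota> z = 0) \<longleftrightarrow> y = 0\<^sub>v d"
proof
  assume *: "\<forall>z\<in>carrier_vec d. y \<bullet> map_vec \<iota> z = 0"
  show "y = 0\<^sub>v d"
  proof (rule eq_vecI)
    fix i assume "i < dim_vec (0\<^sub>v d :: 'e vec)"
    then have i: "i < d" by simp
    have "map_vec \<iota> (unit_vec d i) = unit_vec d i" by (intro eq_vecI) (auto simp: unit_vec_def)
    then have "y \<bullet> unit_vec d i = 0" using * unit_vec_carrier[of d i] by metis
    then show "y $ i = 0\<^sub>v d $ i" using y i by simp
  qed (use y in simp)
qed (simp add: scalar_prod_left_zero)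

text \<open>The shortening of the code \<open>C\<close> to \<open>U\<close>.\<close>

definition subcode_in :: "nat \<Rightarrow> 'e vec set \<Rightarrow> 'f vec set \<Rightarrow> 'e vec set" where
  "subcode_in n C U = {c \<in> C. supp_vec \<iota> bs n c \<subseteq> U}"

lemma subcode_in_eq:
  assumes "C \<subseteq> carrier_vec n" "U \<in> subspaces n"
  shows "subcode_in n C U = {c \<in> C. \<forall>b\<in>perp n U. c \<bullet> map_vec \<iota> b = 0}"
  unfolding subcode_in_def using assms supp_vec_subset_iff[OF _ assms(2)] by blast

text \<open>Supports are defined over the small field, but the dual description consists of
  equations linear over the large one; this yields closure under large scalars.\<close>

lemma subcode_in_subspaces:
  assumes C: "C \<in> subspaces n" and U: "U \<in> subspaces n"
  shows "subcode_in n C U \<in> subspaces n"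
proof -
  have c: "b \<in> carrier_vec n" if "b \<in> perp n U" for b using that by (simp add: perp_def)
  have C': "x \<in> carrier_vec n" if "x \<in> C" for x using subspaces_carrier[OF C] that by blast
  show ?thesis
    unfolding subcode_in_eq[OF subspaces_carrier[OF C] U] subspaces_iff
  proof (intro conjI ballI allI)
    show "{c \<in> C. \<forall>b\<in>perp n U. c \<bullet> map_vec \<iota> b = 0} \<subseteq> carrier_vec n" using C' by blast
    show "0\<^sub>v n \<in> {c \<in> C. \<forall>b\<in>perp n U. c \<bullet> map_vec \<iota> b = 0}"
      using C c by (simp add: subspaces_iff scalar_prod_left_zero)
    show "x + y \<in> {c \<in> C. \<forall>b\<in>perp n U. c \<bullet> map_vec \<iota> b = 0}"
      if "x \<in> {c \<in> C. \<forall>b\<in>perp n U. c \<bullet> map_vec \<iota> b = 0}"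
        "y \<in> {c \<in> C. \<forall>b\<in>perp n U. c \<bullet> map_vec \<iota> b = 0}" for x y
      using that C c C' by (simp add: subspaces_iff add_scalar_prod_distrib[of _ n])
    show "a \<cdot>\<^sub>v x \<in> {c \<in> C. \<forall>b\<in>perp n U. c \<bullet> map_vec \<iota> b = 0}"
      if "x \<in> {c \<in> C. \<forall>b\<in>perp n U. c \<bullet> map_vec \<iota> b = 0}" for a x
      using that C c C' by (simp add: subspaces_iff smult_scalar_prod_distrib[of _ n])
  qed
qed

lemma card_subcodes_supp_subset:
  assumes C: "C \<in> subspaces n" and U: "U \<in> subspaces n"
  shows "card {D \<in> subcodes n C t. supp \<iota> bs n D \<subseteq> U} =
    gauss_binom TYPE('e) (sdim n (subcode_in n C U)) t"
proof -
  have "{D \<in> subcodes n C t. supp \<iota> bs n D \<subseteq> U} =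
      {D \<in> subspaces n. D \<subseteq> subcode_in n C U \<and> sdim n D = t}"
  proof (rule Collect_cong)
    fix D
    have "supp \<iota> bs n D \<subseteq> U \<longleftrightarrow> (\<forall>v\<in>D. supp_vec \<iota> bs n v \<subseteq> U)" if "D \<in> subspaces n"
      using supp_subset_iff[OF subspaces_carrier[OF that] U] .
    then show "D \<in> subcodes n C t \<and> supp \<iota> bs n D \<subseteq> U \<longleftrightarrow>
        D \<in> subspaces n \<and> D \<subseteq> subcode_in n C U \<and> sdim n D = t"
      unfolding subcodes_def subcode_in_def by blast
  qed
  then show ?thesis using card_subspaces_below[OF subcode_in_subspaces[OF C U]] by simp
qed

text \<open>A left inverse of the basis matrix of the complement of \<open>U\<close> survives
  lifting, so the lifted columns stay independent and cut out a space of dimension dim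
  \<open>U\<close> over the large field. The bound confines the indices at which \<open>nu\<close>
  must count.\<close>

lemma sdim_subcode_in_le:
  assumes C: "C \<in> subspaces n" and U: "U \<in> subspaces n"
  shows "sdim n (subcode_in n C U) \<le> sdim n U"
proof -
  define d where "d = sdim n (perp n U)"
  obtain B where B: "B \<in> carrier_mat n d" "perp n U = (*\<^sub>v) B ` carrier_vec d"
    and inj: "inj_on ((*\<^sub>v) B) (carrier_vec d)"
    using subspace_basis_matrix[OF perp_subspace[OF U]] unfolding d_def by metis
  obtain A where A: "A \<in> carrier_mat d n" "A * B = 1\<^sub>m d"
    using left_inverse_of_inj[OF B(1) inj] .
  let ?A = "map_mat \<iota> A" and ?B = "map_mat \<iota> B"
  have B': "?B \<in> carrier_mat n d" and A': "?A \<in> carrier_mat d n" using A B by simp_all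
  have AB: "?A * ?B = 1\<^sub>m d"
    using mat_hom_mult[OF A(1) B(1)] A(2) by (simp add: mat_hom_one)
  have "inj_on ((*\<^sub>v) ?B) (carrier_vec d)"
    unfolding inj_on_mult_mat_vec_iff[OF B']
  proof (intro ballI impI)
    fix x assume x: "x \<in> carrier_vec d" and "?B *\<^sub>v x = 0\<^sub>v n"
    then have "?A *\<^sub>v (?B *\<^sub>v x) = 0\<^sub>v d" using A' by auto
    moreover have "?A *\<^sub>v (?B *\<^sub>v x) = x"
      using assoc_mult_mat_vec[OF A' B' x] AB x by simp
    ultimately show "x = 0\<^sub>v d" by simp
  qed
  then have dim: "sdim n ((*\<^sub>v) ?B ` carrier_vec d) = d"
    using mult_mat_vec_in_subspace_image[OF B']
    by (simp add: sdim_eq_iff_card card_image card_carrier_vec)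
  have "subcode_in n C U \<subseteq> perp n ((*\<^sub>v) ?B ` carrier_vec d)"
  proof
    fix c assume "c \<in> subcode_in n C U"
    then have c: "c \<in> carrier_vec n" and c0: "\<And>b. b \<in> perp n U \<Longrightarrow> c \<bullet> map_vec \<iota> b = 0"
      using subcode_in_eq[OF subspaces_carrier[OF C] U] subspaces_carrier[OF C] by auto
    have "(?B\<^sup>T *\<^sub>v c) \<bullet> map_vec \<iota> z = 0" if z: "z \<in> carrier_vec d" for z
    proof -
      have "(?B\<^sup>T *\<^sub>v c) \<bullet> map_vec \<iota> z = c \<bullet> (?B *\<^sub>v map_vec \<iota> z)"
        using z by (intro transpose_vec_mult_scalar[OF B' _ c]) simp
      also have "?B *\<^sub>v map_vec \<iota> z = map_vec \<iota> (B *\<^sub>v z)"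
        using mult_mat_vec_hom[OF B(1) z] by simp
      also have "c \<bullet> \<dots> = 0" using c0 B(2) z by blast
      finally show ?thesis .
    qed
    then have "?B\<^sup>T *\<^sub>v c = 0\<^sub>v d"
      using all_scalar_prod_hom_eq_0_iff[of "?B\<^sup>T *\<^sub>v c" d] B' c by simp
    then show "c \<in> perp n ((*\<^sub>v) ?B ` carrier_vec d)" using perp_image[OF B'] c by simp
  qed
  then have "sdim n (subcode_in n C U) \<le> sdim n (perp n ((*\<^sub>v) ?B ` carrier_vec d))"
    using mult_mat_vec_in_subspace_image[OF B']
    by (intro sdim_mono subcode_in_subspaces C U) simp_all
  also have "\<dots> = sdim n U"
    using sdim_perp[OF mult_mat_vec_in_subspace_image[OF B']] dim sdim_perp[OF U] sdim_le[OF U]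
    by (simp add: d_def)
  finally show ?thesis .
qed

lemma
  assumes G: "G \<in> carrier_mat k n" and rank: "vec_space.rank k G = k"
    and rep: "represents \<iota> k n G \<rho>" and U: "U \<in> subspaces n"
  shows sdim_subcode_in: "sdim n (subcode_in n (vec_space.row_space n G) U) = k - \<rho> (perp n U)"
    and matroid_rank_le: "\<rho> (perp n U) \<le> k"
proof -
  define d where "d = sdim n (perp n U)"
  obtain B where B: "B \<in> carrier_mat n d" "perp n U = (*\<^sub>v) B ` carrier_vec d"
    using subspace_basis_matrix[OF perp_subspace[OF U]] unfolding d_def by metis
  let ?B = "map_mat \<iota> B" and ?C = "vec_space.row_space n G"
  define H where "H = G * ?B"
  have B': "?B \<in> carrier_mat n d" using B by simp
  have H: "H \<in> carrier_mat k d" using G B' by (simp add: H_def)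
  \<comment> \<open>The representation property speaks of row spaces, hence is applied to the
    transpose of \<open>B\<close>.\<close>
  have "vec_space.row_space n B\<^sup>T = perp n U"
    using row_space_eq_image[of "B\<^sup>T" d n] B by simp
  then have "\<rho> (perp n U) = vec_space.rank k (G * (map_mat \<iota> B\<^sup>T)\<^sup>T)"
    using rep B(1) unfolding represents_def by (metis transpose_carrier_mat)
  also have "(map_mat \<iota> B\<^sup>T)\<^sup>T = ?B" by (simp add: map_mat_transpose[symmetric])
  finally have \<rho>: "\<rho> (perp n U) = sdim k ((*\<^sub>v) H ` carrier_vec d)"
    unfolding H_def[symmetric] rank_eq_sdim_image[OF H] .
  have HI: "(*\<^sub>v) H ` carrier_vec d \<in> subspaces k" by (rule mult_mat_vec_in_subspace_image[OF H])
  show "\<rho> (perp n U) \<le> k" unfolding \<rho> by (rule sdim_le[OF HI])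
  have GI: "(*\<^sub>v) G ` carrier_vec n \<in> subspaces k" by (rule mult_mat_vec_in_subspace_image[OF G])
  \<comment> \<open>Full rank makes the columns of \<open>G\<close> span everything, so the
    transpose of \<open>G\<close> has trivial kernel and encoding is injective: codewords may be
    counted through their messages.\<close>
  have "sdim k (perp k ((*\<^sub>v) G ` carrier_vec n)) = 0"
    using rank unfolding rank_eq_sdim_image[OF G] by (simp add: sdim_perp[OF GI])
  then have "{0\<^sub>v k} = perp k ((*\<^sub>v) G ` carrier_vec n)"
    using perp_subspace[OF GI]
    by (intro subspace_eq_of_sdim[of _ k]) (simp_all add: subspaces_iff[of "perp _ _"])
  then have "{0\<^sub>v k} = {x \<in> carrier_vec k. G\<^sup>T *\<^sub>v x = 0\<^sub>v n}"
    using perp_image[OF G] by simp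
  then have inj: "inj_on ((*\<^sub>v) G\<^sup>T) (carrier_vec k)"
    using inj_on_mult_mat_vec_iff[of "G\<^sup>T" n k] G by auto
  have Ceq: "?C = (*\<^sub>v) G\<^sup>T ` carrier_vec k" by (rule row_space_eq_image[OF G])
  have C: "?C \<in> subspaces n" by (rule row_space_in_subspaces[OF G])
  \<comment> \<open>The equations indexed by the complement of \<open>U\<close> collapse to one
    matrix equation for the message \<open>x\<close>: adjointness moves \<open>G\<close> and the
    lifted \<open>B\<close> to the other side, where lifted vectors detect zero.\<close>
  have iff: "(\<forall>b\<in>perp n U. (G\<^sup>T *\<^sub>v x) \<bullet> map_vec \<iota> b = 0) \<longleftrightarrow> H\<^sup>T *\<^sub>v x = 0\<^sub>v d"
    if x: "x \<in> carrier_vec k" for x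
  proof -
    have "(G\<^sup>T *\<^sub>v x) \<bullet> map_vec \<iota> (B *\<^sub>v z) = (H\<^sup>T *\<^sub>v x) \<bullet> map_vec \<iota> z"
      if z: "z \<in> carrier_vec d" for z
    proof -
      have z': "map_vec \<iota> z \<in> carrier_vec d" using z by simp
      have "map_vec \<iota> (B *\<^sub>v z) = ?B *\<^sub>v map_vec \<iota> z" by (rule mult_mat_vec_hom[OF B(1) z])
      then have "(G\<^sup>T *\<^sub>v x) \<bullet> map_vec \<iota> (B *\<^sub>v z) = x \<bullet> (G *\<^sub>v (?B *\<^sub>v map_vec \<iota> z))"
        using transpose_vec_mult_scalar[OF G _ x, of "?B *\<^sub>v map_vec \<iota> z"] B' z' by simp
      also have "G *\<^sub>v (?B *\<^sub>v map_vec \<iota> z) = H *\<^sub>v map_vec \<iota> z"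
        unfolding H_def by (rule assoc_mult_mat_vec[OF G B' z', symmetric])
      also have "x \<bullet> \<dots> = (H\<^sup>T *\<^sub>v x) \<bullet> map_vec \<iota> z"
        by (rule transpose_vec_mult_scalar[OF H z' x, symmetric])
      finally show ?thesis .
    qed
    then have "(\<forall>b\<in>perp n U. (G\<^sup>T *\<^sub>v x) \<bullet> map_vec \<iota> b = 0) \<longleftrightarrow>
        (\<forall>z\<in>carrier_vec d. (H\<^sup>T *\<^sub>v x) \<bullet> map_vec \<iota> z = 0)"
      unfolding B(2) by simp
    then show ?thesis
      using all_scalar_prod_hom_eq_0_iff[of "H\<^sup>T *\<^sub>v x" d] H x by simp
  qed
  have "subcode_in n ?C U = (*\<^sub>v) G\<^sup>T ` {x \<in> carrier_vec k. H\<^sup>T *\<^sub>v x = 0\<^sub>v d}"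
    unfolding subcode_in_eq[OF subspaces_carrier[OF C] U] unfolding Ceq using iff by blast
  also have "{x \<in> carrier_vec k. H\<^sup>T *\<^sub>v x = 0\<^sub>v d} = perp k ((*\<^sub>v) H ` carrier_vec d)"
    by (rule perp_image[OF H, symmetric])
  finally have eq: "subcode_in n ?C U = (*\<^sub>v) G\<^sup>T ` perp k ((*\<^sub>v) H ` carrier_vec d)" .
  have "inj_on ((*\<^sub>v) G\<^sup>T) (perp k ((*\<^sub>v) H ` carrier_vec d))"
    using inj by (rule inj_on_subset) (rule subspaces_carrier[OF perp_subspace[OF HI]])
  then have "card (subcode_in n ?C U) = card (perp k ((*\<^sub>v) H ` carrier_vec d))"
    unfolding eq by (rule card_image)
  also have "\<dots> = CARD('e) ^ (k - \<rho> (perp n U))"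
    unfolding card_subspace[OF perp_subspace[OF HI]] sdim_perp[OF HI] \<rho> ..
  finally show "sdim n (subcode_in n ?C U) = k - \<rho> (perp n U)"
    using sdim_eq_iff_card[OF subcode_in_subspaces[OF C U]] by simp
qed

end

section \<open>The matrix identities\<close>

text \<open>Both determinants are units, so det \<open>B\<close> times the adjugate of
  \<open>A\<close> is a left inverse, and it coincides with \<open>B\<close>. This needs only a
  commutative ring and thus covers the integers.\<close>

lemma right_inverse_imp_left_inverse:
  fixes A :: "'a::comm_ring_1 mat"
  assumes A: "A \<in> carrier_mat n n" and B: "B \<in> carrier_mat n n" and AB: "A * B = 1\<^sub>m n"
  shows "B * A = 1\<^sub>m n"
proof -
  have d: "det A * det B = 1" using det_mult[OF A B] AB by simp
  define X where "X = det B \<cdot>\<^sub>m adj_mat A"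
  have X: "X \<in> carrier_mat n n" using adj_mat(1)[OF A] by (simp add: X_def)
  have "X * A = det B \<cdot>\<^sub>m (det A \<cdot>\<^sub>m 1\<^sub>m n)"
    unfolding X_def adj_mat(3)[OF A, symmetric] by (rule mult_smult_assoc_mat[OF adj_mat(1)[OF A] A])
  also have "\<dots> = 1\<^sub>m n" using d by (intro eq_matI) (auto simp: mult.commute)
  finally have XA: "X * A = 1\<^sub>m n" .
  have "X = X * (A * B)" using X AB by simp
  also have "\<dots> = B" using assoc_mult_mat[OF X A B] XA B by simp
  finally show ?thesis using XA by simp
qed

lemma invertible_mat_of_right_inverse:
  fixes A :: "'a::comm_ring_1 mat"
  assumes A: "A \<in> carrier_mat n n" and B: "B \<in> carrier_mat n n" and AB: "A * B = 1\<^sub>m n"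
  shows "invertible_mat A" and "mat_inv A = B"
proof -
  have "inverts_mat A B" "inverts_mat B A"
    using right_inverse_imp_left_inverse[OF assms] assms by (simp_all add: inverts_mat_def)
  then show "invertible_mat A" "mat_inv A = B"
    using A mat_inv_eqI by (auto simp: invertible_mat_def)
qed

lemma unit_lower_triangular_invertible:
  fixes A :: "'a::comm_ring_1 mat"
  assumes A: "A \<in> carrier_mat n n"
    and lower: "\<And>i j. i < j \<Longrightarrow> j < n \<Longrightarrow> A $$ (i, j) = 0"
    and diag: "\<And>i. i < n \<Longrightarrow> A $$ (i, i) = 1"
  obtains B where "B \<in> carrier_mat n n" "A * B = 1\<^sub>m n"
proof (rule that)
  have "diag_mat A = replicate n 1"
    using A diag by (intro nth_equalityI) (auto simp: diag_mat_def)
  then have "det A = 1" using det_lower_triangular[OF lower A] by simp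
  then show "A * adj_mat A = 1\<^sub>m n" using adj_mat(2)[OF A] by (auto intro: eq_matI)
  show "adj_mat A \<in> carrier_mat n n" by (rule adj_mat(1)[OF A])
qed

lemma mat_mult_index:
  assumes "A \<in> carrier_mat r s" "B \<in> carrier_mat s t" "i < r" "j < t"
  shows "(A * B) $$ (i, j) = (\<Sum>l<s. A $$ (i, l) * B $$ (l, j))"
  using assms by (auto simp: scalar_prod_def lessThan_atLeast0 intro!: sum.cong)

lemma moebius_inversion:
  fixes f g :: "'f::{field,finite} vec set \<Rightarrow> int"
  assumes f: "\<And>W. W \<in> subspaces n \<Longrightarrow> f W = (\<Sum>U\<in>{U \<in> subspaces n. U \<subseteq> W}. g U)"
    and V: "V \<in> subspaces n"
  shows "(\<Sum>W\<in>subspaces n. moebius n W V * f W) = g V"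
proof -
  have "(\<Sum>W\<in>subspaces n. moebius n W V * f W) =
      (\<Sum>W\<in>subspaces n. \<Sum>U\<in>{U \<in> subspaces n. U \<subseteq> W}. moebius n W V * g U)"
    by (rule sum.cong) (simp_all add: f sum_distrib_left)
  also have "\<dots> = (\<Sum>U\<in>subspaces n. \<Sum>W\<in>{W \<in> subspaces n. U \<subseteq> W}. moebius n W V * g U)"
    by (rule sum.swap_restrict) simp_all
  also have "\<dots> = (\<Sum>U\<in>subspaces n. of_bool (U = V) * g U)"
    by (rule sum.cong) (simp_all only: sum_distrib_right[symmetric] moebius_sum V)
  also have "\<dots> = g V" using V by simp
  finally show ?thesis .
qed

lemma sum_by_sdim:
  fixes f :: "'f::{field,finite} vec set \<Rightarrow> int"
  shows "(\<Sum>W\<in>subspaces n. f W) = (\<Sum>j\<le>n. \<Sum>W\<in>{W \<in> subspaces n. sdim n W = j}. f W)"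
  by (rule sum.group[symmetric]) (auto intro: sdim_le)

text \<open>The origin of the entries of \<open>F_mat\<close>: the summand is constant on the V of
  dimension \<open>i\<close> above \<open>W\<close>, and their number depends only on dim
  \<open>W\<close>. Below dim \<open>W\<close> both sides vanish.\<close>

lemma sum_moebius_fixed_dim:
  fixes W :: "'f::{field,finite} vec set"
  assumes W: "W \<in> subspaces n" and i: "i \<le> n"
  shows "(\<Sum>V\<in>{V \<in> subspaces n. sdim n V = i}. moebius n W V) = F_mat TYPE('f) n $$ (i, sdim n W)"
proof -
  let ?w = "sdim n W"
  let ?h = "(-1) ^ (i - ?w) * int CARD('f) ^ ((i - ?w) choose 2)"
  have w: "?w \<le> n" by (rule sdim_le[OF W])
  have "(\<Sum>V\<in>{V \<in> subspaces n. sdim n V = i}. moebius n W V) =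
      (\<Sum>V\<in>{V \<in> subspaces n. W \<subseteq> V \<and> sdim n V = i}. ?h)"
    by (rule sum.mono_neutral_cong_right) (auto simp: moebius_def)
  also have "\<dots> = ?h * int (gauss_binom TYPE('f) (n - ?w) (n - i))"
    using card_subspaces_above[OF W i] by (simp add: mult.commute)
  also have "\<dots> = F_mat TYPE('f) n $$ (i, ?w)"
  proof (cases "?w \<le> i")
    case True
    then have "gauss_binom TYPE('f) (n - ?w) (n - i) = gauss_binom TYPE('f) (n - ?w) (i - ?w)"
      using gauss_binom_sym[of "i - ?w" "n - ?w", where 'a='f] i by simp
    then show ?thesis using i w True by (simp add: F_mat_def)
  next
    case False
    then have "gauss_binom TYPE('f) (n - ?w) (n - i) = 0"
      using w by (intro gauss_binom_eq_0) simp
    then show ?thesis using i w False by (simp add: F_mat_def)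
  qed
  finally show ?thesis .
qed

lemma F_mat_invertible:
  obtains X where "X \<in> carrier_mat (n + 1) (n + 1)" "F_mat TYPE('f::{field,finite}) n * X = 1\<^sub>m (n + 1)"
  by (rule unit_lower_triangular_invertible[of "F_mat TYPE('f) n" "n + 1"]) (simp_all add: F_mat_def numeral_2_eq_2)

lemma Q_mat_invertible:
  obtains X where "X \<in> carrier_mat (k + 1) (k + 1)" "Q_mat TYPE('e::{field,finite}) k * X = 1\<^sub>m (k + 1)"
  by (rule unit_lower_triangular_invertible[of "Q_mat TYPE('e) k" "k + 1"])
     (simp_all add: Q_mat_def gauss_binom_eq_0)

section \<open>Matrices indexed by the subspace lattice\<close>

lemma sum_nth_subspaces:
  assumes "distinct Vs" "set Vs = subspaces n"
  shows "(\<Sum>r<length Vs. f (Vs ! r)) = (\<Sum>W\<in>subspaces n. f W)"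
  using assms by (intro sum.reindex_bij_betw bij_betw_nth) auto

lemma P_mat_mult_self:
  fixes Vs :: "'f::{field,finite} vec set list"
  assumes Vs: "distinct Vs" "set Vs = subspaces n"
  shows "P_mat n Vs * P_mat n Vs = 1\<^sub>m (length Vs)"
proof (rule eq_matI)
  fix r c assume "r < dim_row (1\<^sub>m (length Vs) :: int mat)" "c < dim_col (1\<^sub>m (length Vs) :: int mat)"
  then have rc: "r < length Vs" "c < length Vs" by simp_all
  have V: "Vs ! r \<in> subspaces n" "Vs ! c \<in> subspaces n" using rc Vs(2) nth_mem by blast+
  have "(P_mat n Vs * P_mat n Vs) $$ (r, c) =
      (\<Sum>s<length Vs. of_bool (Vs ! r = perp n (Vs ! s)) * of_bool (Vs ! s = perp n (Vs ! c)))"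
    using rc by (subst mat_mult_index[of _ "length Vs" "length Vs" _ "length Vs"]) (simp_all add: P_mat_def)
  also have "\<dots> = (\<Sum>W\<in>subspaces n. of_bool (Vs ! r = perp n W) * of_bool (W = perp n (Vs ! c)))"
    by (rule sum_nth_subspaces[OF Vs])
  also have "\<dots> = of_bool (Vs ! r = Vs ! c)"
    using V by (simp add: perp_perp)
  also have "\<dots> = 1\<^sub>m (length Vs) $$ (r, c)"
    using rc Vs(1) by (simp add: nth_eq_iff_index_eq)
  finally show "(P_mat n Vs * P_mat n Vs) $$ (r, c) = 1\<^sub>m (length Vs) $$ (r, c)" .
qed (simp_all add: P_mat_def)

text \<open>The zeta function of the lattice, with the larger argument as row index to agree with
  \<open>M_mat\<close>.\<close>

definition zeta_mat :: "'a set list \<Rightarrow> int mat" where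
  "zeta_mat Vs = mat (length Vs) (length Vs) (\<lambda>(r, c). of_bool (Vs ! c \<subseteq> Vs ! r))"

lemma M_mat_mult_zeta_mat:
  fixes Vs :: "'f::{field,finite} vec set list"
  assumes Vs: "distinct Vs" "set Vs = subspaces n"
  shows "M_mat n Vs * zeta_mat Vs = 1\<^sub>m (length Vs)"
proof (rule eq_matI)
  fix r c assume "r < dim_row (1\<^sub>m (length Vs) :: int mat)" "c < dim_col (1\<^sub>m (length Vs) :: int mat)"
  then have rc: "r < length Vs" "c < length Vs" by simp_all
  have V: "Vs ! r \<in> subspaces n" "Vs ! c \<in> subspaces n" using rc Vs(2) nth_mem by blast+
  have "(M_mat n Vs * zeta_mat Vs) $$ (r, c) =
      (\<Sum>s<length Vs. moebius n (Vs ! s) (Vs ! r) * of_bool (Vs ! c \<subseteq> Vs ! s))"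
    using rc by (subst mat_mult_index[of _ "length Vs" "length Vs" _ "length Vs"]) (simp_all add: M_mat_def zeta_mat_def)
  also have "\<dots> = (\<Sum>W\<in>subspaces n. moebius n W (Vs ! r) * of_bool (Vs ! c \<subseteq> W))"
    by (rule sum_nth_subspaces[OF Vs])
  also have "\<dots> = (\<Sum>W\<in>{W \<in> subspaces n. Vs ! c \<subseteq> W}. moebius n W (Vs ! r))"
    by (rule sum.mono_neutral_cong_right) auto
  also have "\<dots> = of_bool (Vs ! c = Vs ! r)" by (rule moebius_sum[OF V(2,1)])
  also have "\<dots> = 1\<^sub>m (length Vs) $$ (r, c)"
    using rc Vs(1) by (auto simp: nth_eq_iff_index_eq)
  finally show "(M_mat n Vs * zeta_mat Vs) $$ (r, c) = 1\<^sub>m (length Vs) $$ (r, c)" .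
qed (simp_all add: M_mat_def zeta_mat_def)

section \<open>Counting subcodes by support and by weight\<close>

context field_extension_basis
begin

context
  fixes n k :: nat and G :: "'e mat" and \<rho> :: "'f vec set \<Rightarrow> nat" and C :: "'e vec set"
  defines "C \<equiv> vec_space.row_space n G"
  assumes G: "G \<in> carrier_mat k n" and rank: "vec_space.rank k G = k" and rep: "represents \<iota> k n G \<rho>"
begin

lemma C_in_subspaces: "C \<in> subspaces n"
  unfolding C_def by (rule row_space_in_subspaces[OF G])

text \<open>Kept general in \<open>X\<close> for two uses: the subspaces inside a given one, for
  Moebius inversion, and those of a fixed dimension, for weights.\<close>

lemma sum_card_subcodes_supp_eq:
  assumes X: "X \<subseteq> subspaces n"
  shows "(\<Sum>V\<in>X. int (card {D \<in> subcodes n C t. supp \<iota> bs n D = V})) =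
    int (card {D \<in> subcodes n C t. supp \<iota> bs n D \<in> X})"
proof -
  let ?S = "{D \<in> subcodes n C t. supp \<iota> bs n D \<in> X}"
  have fin: "finite ?S" "finite X"
    by (rule finite_subset[of _ "subspaces n"], auto simp: subcodes_def)
       (rule finite_subset[OF X finite_subspaces])
  have "card ?S = (\<Sum>D\<in>?S. 1)" by simp
  also have "\<dots> = (\<Sum>V\<in>X. \<Sum>D\<in>{D \<in> ?S. supp \<iota> bs n D = V}. 1)"
    by (rule sum.group[symmetric]) (use fin in auto)
  also have "\<dots> = (\<Sum>V\<in>X. card {D \<in> subcodes n C t. supp \<iota> bs n D = V})"
  proof (rule sum.cong[OF refl])
    fix V assume "V \<in> X"
    then have "{D \<in> ?S. supp \<iota> bs n D = V} = {D \<in> subcodes n C t. supp \<iota> bs n D = V}" by blast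
    then show "(\<Sum>D\<in>{D \<in> ?S. supp \<iota> bs n D = V}. 1) =
        card {D \<in> subcodes n C t. supp \<iota> bs n D = V}"
      by simp
  qed
  finally show ?thesis by simp
qed

lemma supp_subcode: "D \<in> subcodes n C t \<Longrightarrow> supp \<iota> bs n D \<in> subspaces n"
  using supp_in_subspaces[OF subspaces_carrier, of D n] by (simp add: subcodes_def)

lemma sum_subcodes_supp_subset:
  assumes U: "U \<in> subspaces n"
  shows "(\<Sum>V\<in>{V \<in> subspaces n. V \<subseteq> U}. int (card {D \<in> subcodes n C t. supp \<iota> bs n D = V})) =
    int (gauss_binom TYPE('e) (k - \<rho> (perp n U)) t)"
proof -
  have "{D \<in> subcodes n C t. supp \<iota> bs n D \<in> {V \<in> subspaces n. V \<subseteq> U}} =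
      {D \<in> subcodes n C t. supp \<iota> bs n D \<subseteq> U}"
    using supp_subcode by blast
  moreover have "sdim n (subcode_in n C U) = k - \<rho> (perp n U)"
    unfolding C_def by (rule sdim_subcode_in[OF G rank rep U])
  ultimately show ?thesis
    using sum_card_subcodes_supp_eq[of "{V \<in> subspaces n. V \<subseteq> U}"]
      card_subcodes_supp_subset[OF C_in_subspaces U] by simp
qed

lemma card_subcodes_supp_eq:
  assumes V: "V \<in> subspaces n"
  shows "int (card {D \<in> subcodes n C t. supp \<iota> bs n D = V}) =
    (\<Sum>W\<in>subspaces n. moebius n W V * int (gauss_binom TYPE('e) (k - \<rho> (perp n W)) t))"
  by (rule moebius_inversion[OF sum_subcodes_supp_subset[symmetric] V, symmetric])

lemma corank_le_dim:
  assumes "U \<in> subspaces n"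
  shows "k - \<rho> (perp n U) \<le> sdim n U"
  using sdim_subcode_in_le[OF C_in_subspaces assms] sdim_subcode_in[OF G rank rep assms]
  by (simp add: C_def)

text \<open>The index of \<open>N_mat\<close> is chosen so that the counted V have dimension n - j:
  they are the complements of the W of dimension j.\<close>

lemma nu_eq_card:
  assumes "s \<le> k" "j \<le> n"
  shows "nu n k \<rho> s (int n - int k + int s - int j) =
    card {W \<in> subspaces n. sdim n W = j \<and> k - \<rho> (perp n W) = s}"
proof -
  let ?R = "{W \<in> subspaces n. sdim n W = j \<and> k - \<rho> (perp n W) = s}"
  have le: "\<rho> (perp n W) \<le> k" if "W \<in> subspaces n" for W
    by (rule matroid_rank_le[OF G rank rep that])
  have le': "\<rho> V \<le> sdim n V" if "V \<in> subspaces n" for V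
    using rep that by (simp add: represents_def q_matroid_def)
  show ?thesis
  proof (cases "0 \<le> int n - int k + int s - int j \<and> int n - int k + int s - int j \<le> int n - int k")
    case True
    have "bij_betw (perp n) {V \<in> subspaces n. int (\<rho> V) = int k - int s \<and>
        int (sdim n V) = int k - int s + (int n - int k + int s - int j)} ?R" (is "bij_betw _ ?L _")
    proof (rule bij_betw_byWitness[where f' = "perp n"])
      show "perp n ` ?L \<subseteq> ?R"
        using assms by (auto simp: perp_perp sdim_perp)
      show "perp n ` ?R \<subseteq> ?L"
      proof
        fix V assume "V \<in> perp n ` ?R"
        then obtain W where W: "W \<in> subspaces n" "sdim n W = j" "k - \<rho> (perp n W) = s" "V = perp n W"
          by blast
        show "V \<in> ?L" using W le[OF W(1)] assms by (simp add: sdim_perp of_nat_diff)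
      qed
    qed (simp_all add: perp_perp)
    from bij_betw_same_card[OF this] show ?thesis using True by (simp add: nu_def)
  next
    case False
    \<comment> \<open>An index above n - k means s > j, against \<open>corank_le_dim\<close>. A
      negative index means that the complement of \<open>W\<close> has rank k - s larger than its
      dimension n - j.\<close>
    have "?R = {}"
    proof (rule equals0I)
      fix W assume W: "W \<in> ?R"
      then show False
        using False corank_le_dim[of W] le'[of "perp n W"] le[of W] assms
        by (auto simp: sdim_perp)
    qed
    then show ?thesis using False by (simp only: nu_def if_False card.empty)
  qed
qed

text \<open>Read from the right: \<open>K_mat\<close> selects the row of \<open>Q_mat\<close>
  numbered by k - \<rho>, \<open>P_mat\<close> passes to complements, and \<open>M_mat\<close>
  performs the Moebius inversion.\<close>

lemma S_mat_eq:
  assumes Vs: "distinct Vs" "set Vs = subspaces n"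
  shows "S_mat \<iota> bs n k C Vs = M_mat n Vs * (P_mat n Vs * (K_mat k \<rho> Vs * Q_mat TYPE('e) k))"
proof (rule eq_matI)
  let ?L = "length Vs"
  let ?M = "M_mat n Vs" and ?P = "P_mat n Vs" and ?K = "K_mat k \<rho> Vs" and ?Q = "Q_mat TYPE('e) k"
  let ?g = "\<lambda>s t. int (gauss_binom TYPE('e) s t)"
  fix r t assume "r < dim_row (?M * (?P * (?K * ?Q)))" "t < dim_col (?M * (?P * (?K * ?Q)))"
  then have rt: "r < ?L" "t < k + 1" by (simp_all add: M_mat_def Q_mat_def)
  have c: "?M \<in> carrier_mat ?L ?L" "?P \<in> carrier_mat ?L ?L" "?K \<in> carrier_mat ?L (k + 1)"
    "?Q \<in> carrier_mat (k + 1) (k + 1)"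
    by (simp_all add: M_mat_def P_mat_def K_mat_def Q_mat_def)
  have V: "Vs ! s \<in> subspaces n" if "s < ?L" for s using that Vs(2) nth_mem by blast
  have \<rho>_le: "\<rho> W \<le> k" if "W \<in> subspaces n" for W
    using matroid_rank_le[OF G rank rep perp_subspace[OF that]] that by (simp add: perp_perp)
  have KQ: "(?K * ?Q) $$ (s, t) = ?g (k - \<rho> (Vs ! s)) t" if s: "s < ?L" for s
  proof -
    have le: "\<rho> (Vs ! s) \<le> k" by (rule \<rho>_le[OF V[OF s]])
    have "(?K * ?Q) $$ (s, t) = (\<Sum>j<k + 1. of_bool (int k - int (\<rho> (Vs ! s)) = int j) * ?g j t)"
      using s rt c by (subst mat_mult_index[of _ ?L "k + 1" _ "k + 1"]) (simp_all add: K_mat_def Q_mat_def)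
    \<comment> \<open>Since \<rho> is at most k, truncated subtraction agrees with the integer
      difference in \<open>K_mat\<close>.\<close>
    also have "\<dots> = (\<Sum>j<k + 1. of_bool (k - \<rho> (Vs ! s) = j) * ?g j t)"
      using le by (intro sum.cong refl) (auto simp: of_nat_diff)
    also have "\<dots> = ?g (k - \<rho> (Vs ! s)) t" by simp
    finally show ?thesis .
  qed
  have PKQ: "(?P * (?K * ?Q)) $$ (s, t) = ?g (k - \<rho> (perp n (Vs ! s))) t" if s: "s < ?L" for s
  proof -
    have eq: "Vs ! s = perp n W \<longleftrightarrow> W = perp n (Vs ! s)" if "W \<in> subspaces n" for W
      using perp_perp[OF that] perp_perp[OF V[OF s]] by auto
    have "(?P * (?K * ?Q)) $$ (s, t) =
        (\<Sum>l<?L. of_bool (Vs ! s = perp n (Vs ! l)) * ?g (k - \<rho> (Vs ! l)) t)"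
      using s rt c KQ
      by (subst mat_mult_index[of _ ?L ?L _ "k + 1"]) (simp_all add: P_mat_def del: index_mult_mat)
    also have "\<dots> = (\<Sum>W\<in>subspaces n. of_bool (Vs ! s = perp n W) * ?g (k - \<rho> W) t)"
      by (rule sum_nth_subspaces[OF Vs])
    also have "\<dots> = (\<Sum>W\<in>subspaces n. of_bool (W = perp n (Vs ! s)) * ?g (k - \<rho> W) t)"
      by (rule sum.cong) (simp_all add: eq)
    also have "\<dots> = ?g (k - \<rho> (perp n (Vs ! s))) t" using V[OF s] by simp
    finally show ?thesis .
  qed
  have "(?M * (?P * (?K * ?Q))) $$ (r, t) =
      (\<Sum>s<?L. moebius n (Vs ! s) (Vs ! r) * ?g (k - \<rho> (perp n (Vs ! s))) t)"
    using rt c PKQ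
    by (subst mat_mult_index[of _ ?L ?L _ "k + 1"]) (simp_all add: M_mat_def del: index_mult_mat)
  also have "\<dots> = (\<Sum>W\<in>subspaces n. moebius n W (Vs ! r) * ?g (k - \<rho> (perp n W)) t)"
    by (rule sum_nth_subspaces[OF Vs])
  also have "\<dots> = int (card {D \<in> subcodes n C t. supp \<iota> bs n D = Vs ! r})"
    by (rule card_subcodes_supp_eq[OF V[OF rt(1)], symmetric])
  also have "\<dots> = S_mat \<iota> bs n k C Vs $$ (r, t)" using rt by (simp add: S_mat_def)
  finally show "S_mat \<iota> bs n k C Vs $$ (r, t) = (?M * (?P * (?K * ?Q))) $$ (r, t)" by (rule sym)
qed (simp_all add: S_mat_def M_mat_def Q_mat_def)

text \<open>Adding the inverted formula over all V of dimension i leaves Moebius sums that depend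
  only on dim W. The sum over W can then be grouped by dimension, and inside each dimension by
  corank, which is where \<open>nu\<close> appears.\<close>

lemma A_mat_eq: "A_mat \<iota> bs n k C = F_mat TYPE('f) n * ((N_mat n k \<rho>)\<^sup>T * Q_mat TYPE('e) k)"
proof (rule eq_matI)
  let ?F = "F_mat TYPE('f) n" and ?N = "N_mat n k \<rho>" and ?Q = "Q_mat TYPE('e) k"
  let ?g = "\<lambda>s t. int (gauss_binom TYPE('e) s t)"
  fix i t assume "i < dim_row (?F * (?N\<^sup>T * ?Q))" "t < dim_col (?F * (?N\<^sup>T * ?Q))"
  then have it: "i \<le> n" "t < k + 1" by (simp_all add: F_mat_def Q_mat_def)
  let ?f = "\<lambda>W. ?g (k - \<rho> (perp n W)) t"
  let ?A = "\<lambda>V. {D \<in> subcodes n C t. supp \<iota> bs n D = V}"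
  have c: "?F \<in> carrier_mat (n + 1) (n + 1)" "?N\<^sup>T \<in> carrier_mat (n + 1) (k + 1)"
    "?Q \<in> carrier_mat (k + 1) (k + 1)"
    by (simp_all add: F_mat_def N_mat_def Q_mat_def)
  have NQ: "(?N\<^sup>T * ?Q) $$ (j, t) = (\<Sum>W\<in>{W \<in> subspaces n. sdim n W = j}. ?f W)" if j: "j \<le> n" for j
  proof -
    have "(?N\<^sup>T * ?Q) $$ (j, t) = (\<Sum>s<k + 1. int (nu n k \<rho> s (int n - int k + int s - int j)) * ?g s t)"
      using j it c by (subst mat_mult_index[of _ "n + 1" "k + 1" _ "k + 1"]) (simp_all add: N_mat_def Q_mat_def)
    also have "\<dots> = (\<Sum>s<k + 1. \<Sum>W\<in>{W \<in> {W \<in> subspaces n. sdim n W = j}. k - \<rho> (perp n W) = s}. ?f W)"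
    proof (rule sum.cong[OF refl])
      fix s assume "s \<in> {..<k + 1}"
      then have "nu n k \<rho> s (int n - int k + int s - int j) =
          card {W \<in> {W \<in> subspaces n. sdim n W = j}. k - \<rho> (perp n W) = s}"
        using nu_eq_card[of s j] j by (simp add: conj_assoc)
      then show "int (nu n k \<rho> s (int n - int k + int s - int j)) * ?g s t =
          (\<Sum>W\<in>{W \<in> {W \<in> subspaces n. sdim n W = j}. k - \<rho> (perp n W) = s}. ?f W)"
        by simp
    qed
    also have "\<dots> = (\<Sum>W\<in>{W \<in> subspaces n. sdim n W = j}. ?f W)"
      by (rule sum.group) auto
    finally show ?thesis .
  qed
  have "(?F * (?N\<^sup>T * ?Q)) $$ (i, t) =
      (\<Sum>j<n + 1. ?F $$ (i, j) * (\<Sum>W\<in>{W \<in> subspaces n. sdim n W = j}. ?f W))"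
    using it c NQ
    by (subst mat_mult_index[of _ "n + 1" "n + 1" _ "k + 1"]) (simp_all del: index_mult_mat)
  \<comment> \<open>Writing \<open>sdim n W\<close> for j removes j from the summand, so the
    grouping can be undone.\<close>
  also have "\<dots> = (\<Sum>j\<le>n. \<Sum>W\<in>{W \<in> subspaces n. sdim n W = j}. ?F $$ (i, sdim n W) * ?f W)"
    by (intro sum.cong) (auto simp: sum_distrib_left)
  also have "\<dots> = (\<Sum>W\<in>subspaces n. ?F $$ (i, sdim n W) * ?f W)"
    by (rule sum_by_sdim[symmetric])
  also have "\<dots> = (\<Sum>W\<in>subspaces n. \<Sum>V\<in>{V \<in> subspaces n. sdim n V = i}. moebius n W V * ?f W)"
    by (rule sum.cong) (simp_all add: sum_moebius_fixed_dim[OF _ it(1), symmetric] sum_distrib_right)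
  also have "\<dots> = (\<Sum>V\<in>{V \<in> subspaces n. sdim n V = i}. \<Sum>W\<in>subspaces n. moebius n W V * ?f W)"
    by (rule sum.swap)
  also have "\<dots> = (\<Sum>V\<in>{V \<in> subspaces n. sdim n V = i}. int (card (?A V)))"
    by (rule sum.cong) (simp_all add: card_subcodes_supp_eq)
  also have "\<dots> = int (card {D \<in> subcodes n C t. wt \<iota> bs n D = i})"
  proof -
    have "{D \<in> subcodes n C t. supp \<iota> bs n D \<in> {V \<in> subspaces n. sdim n V = i}} =
        {D \<in> subcodes n C t. wt \<iota> bs n D = i}"
      using supp_subcode by (auto simp: wt_def)
    then show ?thesis
      using sum_card_subcodes_supp_eq[of "{V \<in> subspaces n. sdim n V = i}"] by simp
  qed
  also have "\<dots> = A_mat \<iota> bs n k C $$ (i, t)" using it by (simp add: A_mat_def)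
  finally show "A_mat \<iota> bs n k C $$ (i, t) = (?F * (?N\<^sup>T * ?Q)) $$ (i, t)" by (rule sym)
qed (simp_all add: A_mat_def F_mat_def Q_mat_def)

end

end

theorem theorem4p4:
  fixes \<iota> :: "'f::{field,finite} \<Rightarrow> 'e::{field,finite}"
    and m n k :: nat
    and bs :: "'e list"
    and G :: "'e mat"
    and \<rho> :: "'f vec set \<Rightarrow> nat"
    and Vs :: "'f vec set list"
  defines "C \<equiv> vec_space.row_space n G"
  defines "S \<equiv> S_mat \<iota> bs n k C Vs"
    and "A \<equiv> A_mat \<iota> bs n k C"
    and "P \<equiv> P_mat n Vs"
    and "M \<equiv> M_mat n Vs"
    and "F \<equiv> F_mat TYPE('f) n"
    and "Q \<equiv> Q_mat TYPE('e) k"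
    and "N \<equiv> N_mat n k \<rho>"
    and "K \<equiv> K_mat k \<rho> Vs"
  assumes "m \<ge> 1"
    and "field_hom \<iota>"
    and "CARD('e) = CARD('f) ^ m"
    and "ordered_basis \<iota> bs"
    and "distinct Vs" and "set Vs = subspaces n"
    and "G \<in> carrier_mat k n" and "vec_space.rank k G = k"
    and "represents \<iota> k n G \<rho>"
  shows "(S = M * P * K * Q \<and>
          invertible_mat P \<and> invertible_mat M \<and> invertible_mat Q \<and>
          K = P * mat_inv M * S * mat_inv Q) \<and>
         (A = F * N\<^sup>T * Q \<and>
          invertible_mat F \<and> invertible_mat Q \<and>
          N\<^sup>T = mat_inv F * A * mat_inv Q)"
proof -
  interpret field_hom \<iota> by fact
  interpret field_extension_basis \<iota> bs
    by unfold_locales (fact \<open>ordered_basis \<iota> bs\<close>)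
  let ?L = "length Vs"
  \<comment> \<open>The inverse of M. As P is its own inverse, P itself can stand on the left in the
    formula for K.\<close>
  define Z where "Z = zeta_mat Vs"
  have M: "M \<in> carrier_mat ?L ?L" and P: "P \<in> carrier_mat ?L ?L" and Z: "Z \<in> carrier_mat ?L ?L"
    and K: "K \<in> carrier_mat ?L (k + 1)" and Q: "Q \<in> carrier_mat (k + 1) (k + 1)"
    and F: "F \<in> carrier_mat (n + 1) (n + 1)" and NT: "N\<^sup>T \<in> carrier_mat (n + 1) (k + 1)"
    by (simp_all add: M_def P_def Z_def K_def Q_def F_def N_def
        M_mat_def P_mat_def zeta_mat_def K_mat_def Q_mat_def F_mat_def N_mat_def)
  note Vs = \<open>distinct Vs\<close> \<open>set Vs = subspaces n\<close>
  note GR = \<open>G \<in> carrier_mat k n\<close> \<open>vec_space.rank k G = k\<close> \<open>represents \<iota> k n G \<rho>\<close>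
  have PP: "P * P = 1\<^sub>m ?L" unfolding P_def by (rule P_mat_mult_self[OF Vs])
  have MZ: "M * Z = 1\<^sub>m ?L" unfolding M_def Z_def by (rule M_mat_mult_zeta_mat[OF Vs])
  obtain Q' where Q': "Q' \<in> carrier_mat (k + 1) (k + 1)" and QQ': "Q * Q' = 1\<^sub>m (k + 1)"
    unfolding Q_def by (rule Q_mat_invertible)
  obtain F' where F': "F' \<in> carrier_mat (n + 1) (n + 1)" and FF': "F * F' = 1\<^sub>m (n + 1)"
    unfolding F_def by (rule F_mat_invertible)
  note P_inv = invertible_mat_of_right_inverse[OF P P PP]
    and M_inv = invertible_mat_of_right_inverse[OF M Z MZ]
    and Q_inv = invertible_mat_of_right_inverse[OF Q Q' QQ']
    and F_inv = invertible_mat_of_right_inverse[OF F F' FF']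
  have ZM: "Z * M = 1\<^sub>m ?L" by (rule right_inverse_imp_left_inverse[OF M Z MZ])
  have F'F: "F' * F = 1\<^sub>m (n + 1)" by (rule right_inverse_imp_left_inverse[OF F F' FF'])
  have PK: "P * K \<in> carrier_mat ?L (k + 1)" using P K by simp
  have S: "S = M * ((P * K) * Q)"
    using S_mat_eq[OF GR Vs] assoc_mult_mat[OF P K Q]
    unfolding S_def C_def M_def P_def K_def Q_def by simp
  have A: "A = F * (N\<^sup>T * Q)"
    using A_mat_eq[OF GR] unfolding A_def C_def F_def N_def Q_def .
  have S': "S = M * P * K * Q"
    unfolding S using M P K Q PK by (simp add: assoc_mult_mat[of _ ?L ?L _ "k + 1" _ "k + 1"] assoc_mult_mat[of _ ?L ?L _ ?L _ "k + 1"])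
  have PKQ: "(P * K) * Q \<in> carrier_mat ?L (k + 1)" and NQ: "N\<^sup>T * Q \<in> carrier_mat (n + 1) (k + 1)"
    using PK NT Q by simp_all
  have ZS: "Z * S = (P * K) * Q"
    unfolding S assoc_mult_mat[OF Z M PKQ, symmetric] ZM by (rule left_mult_one_mat[OF PKQ])
  have ZSQ: "Z * S * Q' = P * K"
    unfolding ZS assoc_mult_mat[OF PK Q Q'] QQ' by (rule right_mult_one_mat[OF PK])
  have Sc: "S \<in> carrier_mat ?L (k + 1)" unfolding S using M PKQ by simp
  have "P * Z * S * Q' = P * (Z * S * Q')"
    unfolding assoc_mult_mat[OF P Z Sc] by (rule assoc_mult_mat[OF P mult_carrier_mat[OF Z Sc] Q'])
  also have "\<dots> = K"
    unfolding ZSQ assoc_mult_mat[OF P P K, symmetric] PP by (rule left_mult_one_mat[OF K])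
  finally have K_eq: "K = P * mat_inv M * S * mat_inv Q"
    unfolding M_inv(2) Q_inv(2) by (rule sym)
  have FA: "F' * A = N\<^sup>T * Q"
    unfolding A assoc_mult_mat[OF F' F NQ, symmetric] F'F by (rule left_mult_one_mat[OF NQ])
  have "F' * A * Q' = N\<^sup>T"
    unfolding FA assoc_mult_mat[OF NT Q Q'] QQ' by (rule right_mult_one_mat[OF NT])
  then have N_eq: "N\<^sup>T = mat_inv F * A * mat_inv Q"
    unfolding F_inv(2) Q_inv(2) by (rule sym)
  have A': "A = F * N\<^sup>T * Q" unfolding A by (rule assoc_mult_mat[OF F NT Q, symmetric])
  show ?thesis
    using S' A' K_eq N_eq P_inv(1) M_inv(1) Q_inv(1) F_inv(1) by (intro conjI)
qed

end
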